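(* Let $G$ be a compact Hausdorff group and $X$ a complete operator space. If $\mu\in M(G)$ and $\nu\in\mathcal{M}(G,X)$, then for $[\pi]\in\widehat{G}$, $$\widehat{\mu*\nu}(\pi)=d_\pi\,\widehat{\nu}(\pi)\widehat{\mu}(\pi).$$
   Context: $M(G)$ is the space of complex Radon measures on $G$. $\mathcal{M}(G,X)$ is the space of $\sigma$-additive $X$-valued vector measures $\nu$ on the Borel $\sigma$-algebra $\mathfrak{B}(G)$ that are regular: for each $\epsilon>0$ and $A\in\mathfrak{B}(G)$ there are an open $U$ and a closed $F$ with $F\subset A\subset U$ and $\|\nu\|(U\setminus F)<\epsilon$, where $\|\nu\|(B)=\sup_{x'\in B_{X'}}|\langle\nu,x'\rangle|(B)$ is the semivariation ($B_{X'}$ the closed unit ball of the dual, $\langle\nu,x'\rangle(A)=\langle\nu(A),x'\rangle$). The convolution is the $X$-valued vector measure $\mu*\nu(A)=\int_G\mu(At^{-1})\,d\nu(t)$, $A\in\mathfrak{B}(G)$. For a bounded Borel $f$, $\int_Gf\,d\nu\in X$ is the element with $\langle\int_Gf\,d\nu,x'\rangle=\int_Gf\,d\langle\nu,x'\rangle$ for all $x'\in X'$. $\widehat G$ is the set of classes of irreducible unitary representations $\pi$ of $G$, $d_\pi=\dim\mathcal{H}_\pi$, $\pi(t)_{ij}=\langle\pi(t)e_j^\pi,e_i^\pi\rangle$ for a fixed ordered orthonormal basis. For a vector measure $\nu$, $\widehat\nu(\pi)\in M_{d_\pi}(X)$ has entries $\frac1{d_\pi}\int_G\overline{\pi(t)_{ji}}\,d\nu(t)$,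 and $\widehat\mu(\pi)\in M_{d_\pi}$ has entries $\frac1{d_\pi}\int_G\overline{\pi(t)_{ji}}\,d\mu(t)$. $\widehat\nu(\pi)\widehat\mu(\pi)$ is the matrix product, with entries $\sum_k\widehat\mu(\pi)_{kj}\widehat\nu(\pi)_{ik}\in X$. *)

theory Defs
  imports "HOL-Analysis.Analysis" "HOL-Algebra.Coset" "Jordan_Normal_Form.Matrix"
begin

section \<open>Complex normed spaces and complex inner product spaces\<close>

class complex_normed_vector = real_normed_vector +
  fixes scaleC :: "complex \<Rightarrow> 'a \<Rightarrow> 'a"  (infixr "*\<^sub>C" 75)
  assumes scaleC_add_right: "c *\<^sub>C (x + y) = c *\<^sub>C x + c *\<^sub>C y"
    and scaleC_add_left: "(c + d) *\<^sub>C x = c *\<^sub>C x + d *\<^sub>C x"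
    and scaleC_scaleC: "c *\<^sub>C d *\<^sub>C x = (c * d) *\<^sub>C x"
    and scaleC_of_real: "complex_of_real r *\<^sub>C x = r *\<^sub>R x"
    and norm_scaleC: "norm (c *\<^sub>C x) = cmod c * norm x"

text \<open>The inner product is linear in the first and conjugate linear in the second argument.
  Positive definiteness is contained in the last axiom, since \<^term>\<open>norm\<close> is a norm.\<close>

class complex_inner = complex_normed_vector +
  fixes cinner :: "'a \<Rightarrow> 'a \<Rightarrow> complex"
  assumes cinner_add_left: "cinner (x + y) z = cinner x z + cinner y z"
    and cinner_scaleC_left: "cinner (c *\<^sub>C x) y = c * cinner x y"
    and cinner_commute: "cinner x y = cnj (cinner y x)"
    and cinner_self: "cinner x x = complex_of_real ((norm x)\<^sup>2)"

instantiation complex :: complex_inner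
begin
definition scaleC_complex :: "complex \<Rightarrow> complex \<Rightarrow> complex" where "scaleC_complex c x = c * x"
definition cinner_complex :: "complex \<Rightarrow> complex \<Rightarrow> complex" where "cinner_complex x y = x * cnj y"
instance
  by standard
    (auto simp: scaleC_complex_def cinner_complex_def algebra_simps scaleR_conv_of_real norm_mult
        complex_norm_square[symmetric])
end

definition dual_space :: "('x::complex_normed_vector \<Rightarrow> complex) set" where
  "dual_space = {\<phi>. bounded_linear \<phi> \<and> (\<forall>c x. \<phi> (c *\<^sub>C x) = c * \<phi> x)}"

definition dual_unit_ball :: "('x::complex_normed_vector \<Rightarrow> complex) set" where
  "dual_unit_ball = {\<phi> \<in> dual_space. onorm \<phi> \<le> 1}"


section \<open>Operator spaces\<close>

definition mat_lmult :: "complex mat \<Rightarrow> 'x::complex_normed_vector mat \<Rightarrow> 'x mat" where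
  "mat_lmult \<alpha> x = Matrix.mat (dim_row \<alpha>) (dim_col x)
     (\<lambda>(i, j). \<Sum>k<dim_row x. (\<alpha> $$ (i, k)) *\<^sub>C (x $$ (k, j)))"

definition mat_rmult :: "'x::complex_normed_vector mat \<Rightarrow> complex mat \<Rightarrow> 'x mat" where
  "mat_rmult x \<beta> = Matrix.mat (dim_row x) (dim_col \<beta>)
     (\<lambda>(i, j). \<Sum>k<dim_col x. (\<beta> $$ (k, j)) *\<^sub>C (x $$ (i, k)))"

definition direct_sum_mat :: "'x::zero mat \<Rightarrow> 'x mat \<Rightarrow> 'x mat" where
  "direct_sum_mat x y =
     four_block_mat x (0\<^sub>m (dim_row x) (dim_col y)) (0\<^sub>m (dim_row y) (dim_col x)) y"

definition l2_norm_vec :: "complex Matrix.vec \<Rightarrow> real" where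
  "l2_norm_vec v = L2_set (\<lambda>i. cmod (vec_index v i)) {..<dim_vec v}"

definition mat_opnorm :: "complex mat \<Rightarrow> real" where
  "mat_opnorm \<alpha> =
     (SUP v\<in>{v \<in> carrier_vec (dim_col \<alpha>). l2_norm_vec v \<le> 1}. l2_norm_vec (\<alpha> *\<^sub>v v))"

text \<open>Ruan's axioms for a family of norms on the spaces of square matrices over \<^typ>\<open>'x\<close>. The
  values of \<^term>\<open>mnorm\<close> on non-square matrices are irrelevant. Completeness is not part of the
  locale; a complete operator space is one whose type \<^typ>\<open>'x\<close> is moreover of class
  \<^class>\<open>banach\<close>.\<close>

locale operator_space =
  fixes mnorm :: "'x::complex_normed_vector mat \<Rightarrow> real"
  assumes mnorm_eq_0_iff: "x \<in> carrier_mat n n \<Longrightarrow> mnorm x = 0 \<longleftrightarrow> x = 0\<^sub>m n n"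
    and mnorm_triangle:
      "x \<in> carrier_mat n n \<Longrightarrow> y \<in> carrier_mat n n \<Longrightarrow> mnorm (x + y) \<le> mnorm x + mnorm y"
    and mnorm_scaleC:
      "x \<in> carrier_mat n n \<Longrightarrow> mnorm (map_mat (\<lambda>z. c *\<^sub>C z) x) = cmod c * mnorm x"
    and mnorm_1: "mnorm (Matrix.mat 1 1 (\<lambda>_. a)) = norm a"
    and mnorm_direct_sum:
      "x \<in> carrier_mat m m \<Longrightarrow> y \<in> carrier_mat n n \<Longrightarrow>
         mnorm (direct_sum_mat x y) = max (mnorm x) (mnorm y)"
    and mnorm_bimodule:
      "\<alpha> \<in> carrier_mat n m \<Longrightarrow> x \<in> carrier_mat m m \<Longrightarrow> \<beta> \<in> carrier_mat m n \<Longrightarrow>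
         mnorm (mat_rmult (mat_lmult \<alpha> x) \<beta>) \<le> mat_opnorm \<alpha> * mnorm x * mat_opnorm \<beta>"


section \<open>Complex and vector measures on a topological space\<close>

text \<open>Measures with values in a normed space are functions on all subsets; only the values on Borel
  sets are meaningful.\<close>

definition borel_algebra :: "'g topology \<Rightarrow> 'g measure" where
  "borel_algebra T = sigma (topspace T) {U. openin T U}"

definition vector_measure :: "'g topology \<Rightarrow> ('g set \<Rightarrow> 'x::real_normed_vector) \<Rightarrow> bool" where
  "vector_measure T \<nu> \<longleftrightarrow>
     (\<forall>A :: nat \<Rightarrow> 'g set. range A \<subseteq> sets (borel_algebra T) \<longrightarrow> disjoint_family A \<longrightarrow>
        (\<lambda>n. \<nu> (A n)) sums \<nu> (\<Union>n. A n))"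

definition total_variation :: "'g topology \<Rightarrow> ('g set \<Rightarrow> complex) \<Rightarrow> 'g set \<Rightarrow> ennreal" where
  "total_variation T \<mu> B =
     (SUP P\<in>{P. finite P \<and> P \<subseteq> sets (borel_algebra T) \<and> disjoint P \<and> \<Union>P = B}.
        \<Sum>A\<in>P. ennreal (cmod (\<mu> A)))"

definition semivariation ::
    "'g topology \<Rightarrow> ('g set \<Rightarrow> 'x::complex_normed_vector) \<Rightarrow> 'g set \<Rightarrow> ennreal" where
  "semivariation T \<nu> B = (SUP \<phi>\<in>dual_unit_ball. total_variation T (\<lambda>A. \<phi> (\<nu> A)) B)"

text \<open>The inner approximating sets \<open>F\<close> are those satisfying \<^term>\<open>approx\<close>: compact sets for Radon
  measures, closed sets for vector measures.\<close>

definition regular_wrt ::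
    "'g topology \<Rightarrow> ('g set \<Rightarrow> bool) \<Rightarrow> ('g set \<Rightarrow> ennreal) \<Rightarrow> bool" where
  "regular_wrt T approx v \<longleftrightarrow>
     (\<forall>\<epsilon>::real. \<epsilon> > 0 \<longrightarrow> (\<forall>A\<in>sets (borel_algebra T).
        \<exists>U F. openin T U \<and> approx F \<and> F \<subseteq> A \<and> A \<subseteq> U \<and> v (U - F) < ennreal \<epsilon>))"

definition radon_measures :: "'g topology \<Rightarrow> ('g set \<Rightarrow> complex) set" where
  "radon_measures T =
     {\<mu>. vector_measure T \<mu> \<and> regular_wrt T (compactin T) (total_variation T \<mu>)}"

definition regular_vector_measures ::
    "'g topology \<Rightarrow> ('g set \<Rightarrow> 'x::complex_normed_vector) set" where
  "regular_vector_measures T =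
     {\<nu>. vector_measure T \<nu> \<and> regular_wrt T (closedin T) (semivariation T \<nu>)}"


subsection \<open>Integration\<close>

text \<open>Integrals against a complex measure are defined through the Jordan decompositions
  of its real and imaginary parts. The positive variation of a real measure \<open>\<rho>\<close> is
  \<open>\<rho>\<^sup>+(A) = sup {\<rho>(B) | B \<subseteq> A}\<close>; as \<^term>\<open>ennreal\<close> truncates negative numbers to \<open>0 = \<rho>({})\<close>, the
  supremum may be taken in \<^typ>\<open>ennreal\<close>. The negative variation is the positive variation
  of \<open>-\<rho>\<close>.\<close>

definition positive_variation :: "'g topology \<Rightarrow> ('g set \<Rightarrow> real) \<Rightarrow> 'g measure" where
  "positive_variation T \<rho> = measure_of (topspace T) (sets (borel_algebra T))
     (\<lambda>A. SUP B\<in>{B \<in> sets (borel_algebra T). B \<subseteq> A}. ennreal (\<rho> B))"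

definition signed_integral :: "'g topology \<Rightarrow> ('g set \<Rightarrow> real) \<Rightarrow> ('g \<Rightarrow> complex) \<Rightarrow> complex" where
  "signed_integral T \<rho> f =
     (LINT t|positive_variation T \<rho>. f t) - (LINT t|positive_variation T (\<lambda>A. - \<rho> A). f t)"

definition complex_integral ::
    "'g topology \<Rightarrow> ('g set \<Rightarrow> complex) \<Rightarrow> ('g \<Rightarrow> complex) \<Rightarrow> complex" where
  "complex_integral T \<mu> f =
     signed_integral T (\<lambda>A. Re (\<mu> A)) f + \<i> * signed_integral T (\<lambda>A. Im (\<mu> A)) f"

definition vector_integral ::
    "'g topology \<Rightarrow> ('g set \<Rightarrow> 'x::complex_normed_vector) \<Rightarrow> ('g \<Rightarrow> complex) \<Rightarrow> 'x" where
  "vector_integral T \<nu> f =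
     (THE y. \<forall>\<phi>\<in>dual_space. \<phi> y = complex_integral T (\<lambda>A. \<phi> (\<nu> A)) f)"


section \<open>Compact groups and their irreducible representations\<close>

locale compact_hausdorff_group = group G for G (structure) +
  fixes T :: "'g topology"
  assumes topspace_eq: "topspace T = carrier G"
    and compact: "compact_space T"
    and Hausdorff: "Hausdorff_space T"
    and continuous_mult: "continuous_map (prod_topology T T) T (\<lambda>(s, t). s \<otimes> t)"
    and continuous_inv: "continuous_map T T (\<lambda>t. inv t)"

definition conv ::
    "('g, 'm) monoid_scheme \<Rightarrow> 'g topology \<Rightarrow> ('g set \<Rightarrow> complex) \<Rightarrow>
     ('g set \<Rightarrow> 'x::complex_normed_vector) \<Rightarrow> 'g set \<Rightarrow> 'x" where
  "conv G T \<mu> \<nu> A = vector_integral T \<nu> (\<lambda>t. \<mu> (A #>\<^bsub>G\<^esub> inv\<^bsub>G\<^esub> t))"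

definition unitary_operator :: "('h::complex_inner \<Rightarrow> 'h) \<Rightarrow> bool" where
  "unitary_operator U \<longleftrightarrow>
     (\<forall>x y. U (x + y) = U x + U y) \<and> (\<forall>c x. U (c *\<^sub>C x) = c *\<^sub>C U x) \<and>
     (\<forall>x y. cinner (U x) (U y) = cinner x y) \<and> surj U"

text \<open>Representations are strongly continuous; irreducibility refers to closed invariant
  subspaces. The Hilbert space is the whole type \<^typ>\<open>'h\<close>.\<close>

locale irreducible_unitary_rep =
  fixes G :: "('g, 'm) monoid_scheme" (structure) and T :: "'g topology"
    and \<pi> :: "'g \<Rightarrow> 'h::{complex_inner, banach} \<Rightarrow> 'h"
  assumes unitary: "t \<in> carrier G \<Longrightarrow> unitary_operator (\<pi> t)"
    and mult: "s \<in> carrier G \<Longrightarrow> t \<in> carrier G \<Longrightarrow> \<pi> (s \<otimes> t) = \<pi> s \<circ> \<pi> t"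
    and strongly_continuous: "continuous_map T euclidean (\<lambda>t. \<pi> t h)"
    and nonzero: "\<exists>h::'h. h \<noteq> 0"
    and irreducible:
      "module.subspace scaleC V \<Longrightarrow> closed V \<Longrightarrow> (\<And>t. t \<in> carrier G \<Longrightarrow> \<pi> t ` V \<subseteq> V) \<Longrightarrow>
         V = {0} \<or> V = UNIV"

definition cdim :: "'h::complex_normed_vector itself \<Rightarrow> nat" where
  "cdim _ = vector_space.dim scaleC (UNIV :: 'h set)"

text \<open>An ordered orthonormal basis, indexed from \<open>0\<close>. Its existence forces the space to be
  finite-dimensional (in infinite dimensions \<^const>\<open>cdim\<close> is \<open>0\<close>).\<close>

definition orthonormal_basis :: "(nat \<Rightarrow> 'h::complex_inner) \<Rightarrow> bool" where
  "orthonormal_basis e \<longleftrightarrow>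
     (\<forall>i<cdim TYPE('h). \<forall>j<cdim TYPE('h). cinner (e i) (e j) = (if i = j then 1 else 0)) \<and>
     module.span scaleC (e ` {..<cdim TYPE('h)}) = UNIV"

definition matrix_coeff ::
    "('g \<Rightarrow> 'h::complex_inner \<Rightarrow> 'h) \<Rightarrow> (nat \<Rightarrow> 'h) \<Rightarrow> nat \<Rightarrow> nat \<Rightarrow> 'g \<Rightarrow> complex" where
  "matrix_coeff \<pi> e i j t = cinner (\<pi> t (e j)) (e i)"


section \<open>Fourier coefficients\<close>

definition fourier_measure ::
    "'g topology \<Rightarrow> ('g \<Rightarrow> 'h::complex_inner \<Rightarrow> 'h) \<Rightarrow> (nat \<Rightarrow> 'h) \<Rightarrow>
     ('g set \<Rightarrow> complex) \<Rightarrow> complex mat" where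
  "fourier_measure T \<pi> e \<mu> = Matrix.mat (cdim TYPE('h)) (cdim TYPE('h))
     (\<lambda>(i, j). 1 / of_nat (cdim TYPE('h)) *
        complex_integral T \<mu> (\<lambda>t. cnj (matrix_coeff \<pi> e j i t)))"

definition fourier_vector_measure ::
    "'g topology \<Rightarrow> ('g \<Rightarrow> 'h::complex_inner \<Rightarrow> 'h) \<Rightarrow> (nat \<Rightarrow> 'h) \<Rightarrow>
     ('g set \<Rightarrow> 'x::complex_normed_vector) \<Rightarrow> 'x mat" where
  "fourier_vector_measure T \<pi> e \<nu> = Matrix.mat (cdim TYPE('h)) (cdim TYPE('h))
     (\<lambda>(i, j). (1 / of_nat (cdim TYPE('h))) *\<^sub>C
        vector_integral T \<nu> (\<lambda>t. cnj (matrix_coeff \<pi> e j i t)))"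

end

theory Submission
  imports Defs
begin

text \<open>Write \<open>f = cnj (matrix_coeff \<pi> e j i)\<close>. Formally the theorem is Fubini followed by
  \<open>\<pi> (s t) = \<pi> s \<pi> t\<close>:
  \<open>\<integral> f d(\<mu> * \<nu>) = \<integral>\<integral> f (s t) d\<mu>(s) d\<nu>(t)\<close>, the function \<open>f (s t)\<close> is the sum over \<open>k\<close> of
  \<open>cnj (matrix_coeff \<pi> e j k s) * cnj (matrix_coeff \<pi> e k i t)\<close>, and so the double integral is a sum
  of products of Fourier coefficients. The factor \<open>d\<close> arises because the product of two coefficients
  carries \<open>1/d\<^sup>2\<close> and a single one \<open>1/d\<close>.

  No product measure is formed. On a nonmetrizable group the Borel sets of \<open>G \<times> G\<close> need not be generated
  by rectangles, so the usual Fubini theorem would not apply to the indicator of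
  \<open>{(s, t). s t \<in> A}\<close>, whose iterated integral is the value of the convolution at \<open>A\<close>. Instead the identity
  above holds for indicators by this very definition, and it survives linear
  combinations and bounded pointwise limits (\<open>complex_integral_convolution\<close>). This uses two facts:
  \<open>t \<mapsto> \<mu> (A t\<^sup>-\<^sup>1)\<close> is Borel measurable (\<open>bounded_borel_translate\<close>), and the scalar convolution is
  countably additive (\<open>vector_measure_convolution\<close>). The measurability is where the regularity of \<open>\<mu>\<close>
  and the compact topology enter: for open \<open>A\<close> and positive \<open>\<mu>\<close> the function is lower semicontinuous,
  and a Dynkin argument passes to all Borel sets.

  Vector integrals are reduced to scalar ones by functionals. This needs a Hahn-Banach theorem
  for uniqueness (\<open>dual_space_eqI\<close>) and an element of the Banach space for existence
  (\<open>dual_vector_integral\<close>). The latter is the series \<open>\<Sum>n. 2\<^sup>-\<^sup>n \<nu> (A n)\<close> read off from the binary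
  digits of the integrand. It converges because a countably additive vector measure has
  bounded range (\<open>vector_measure_bounded\<close>).\<close>

section \<open>Functionals separate points\<close>

definition sublinear :: "('a::real_vector \<Rightarrow> real) \<Rightarrow> bool" where
  "sublinear p \<longleftrightarrow>
     (\<forall>x y. p (x + y) \<le> p x + p y) \<and> (\<forall>r x. 0 \<le> r \<longrightarrow> p (r *\<^sub>R x) = r * p x)"

lemma sublinear_add: "sublinear p \<Longrightarrow> p (x + y) \<le> p x + p y"
  and sublinear_scaleR: "sublinear p \<Longrightarrow> 0 \<le> r \<Longrightarrow> p (r *\<^sub>R x) = r * p x"
  by (auto simp: sublinear_def)

lemma sublinear_0: "sublinear p \<Longrightarrow> p 0 = 0"
  using sublinear_scaleR[of p 0 0] by simp

lemma sublinearI: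
  fixes p :: "'a::real_vector \<Rightarrow> real"
  assumes add: "\<And>x y. p (x + y) \<le> p x + p y" and "p 0 = 0"
    and scale: "\<And>r x. 0 < r \<Longrightarrow> p (r *\<^sub>R x) \<le> r * p x"
  shows "sublinear p"
  unfolding sublinear_def
proof (intro conjI allI impI add)
  fix r :: real and x assume "0 \<le> r"
  show "p (r *\<^sub>R x) = r * p x"
  proof (cases "r = 0")
    case False
    then have "0 < r" using \<open>0 \<le> r\<close> by simp
    have "p x = p (inverse r *\<^sub>R r *\<^sub>R x)" using False by simp
    also have "\<dots> \<le> inverse r * p (r *\<^sub>R x)" by (rule scale) (use \<open>0 < r\<close> in simp)
    finally have "r * p x \<le> p (r *\<^sub>R x)" using \<open>0 < r\<close> by (simp add: field_simps)
    then show ?thesis using scale[OF \<open>0 < r\<close>, of x] by simp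
  qed (use \<open>p 0 = 0\<close> in simp)
qed

lemma sublinear_norm: "sublinear (norm :: 'a::real_normed_vector \<Rightarrow> real)"
  by (rule sublinearI) (auto intro: norm_triangle_ineq)

lemma sublinear_lower:
  assumes "sublinear p" "\<And>x. p x \<le> q x"
  shows "- q (- x) \<le> p x"
  using sublinear_add[OF assms(1), of x "- x"] sublinear_0[OF assms(1)] assms(2)[of "- x"] by simp

text \<open>A sublinear functional \<open>p\<close> is lowered in the direction \<open>y\<close>: \<open>tilt p y\<close> is again sublinear and below
  \<open>p\<close>, and \<open>tilt p y (- y) \<le> - p y\<close>. Hence a minimal sublinear functional equals all its tilts, which
  makes it additive. Tilting the norm at \<open>x\<close> first ensures that a linear functional below the tilt
  does not vanish at a nonzero \<open>x\<close>.\<close>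

definition tilt :: "('a::real_vector \<Rightarrow> real) \<Rightarrow> 'a \<Rightarrow> 'a \<Rightarrow> real" where
  "tilt p y x = (INF t\<in>{0..}. p (x + t *\<^sub>R y) - t * p y)"

lemma tilt_le:
  assumes p: "sublinear p" and "0 \<le> t"
  shows "tilt p y x \<le> p (x + t *\<^sub>R y) - t * p y"
  unfolding tilt_def
proof (rule cINF_lower)
  show "bdd_below ((\<lambda>t. p (x + t *\<^sub>R y) - t * p y) ` {0..})"
  proof (rule bdd_belowI2)
    fix t :: real assume "t \<in> {0..}"
    then have "t * p y = p ((x + t *\<^sub>R y) + (- x))" using sublinear_scaleR[OF p] by simp
    also have "\<dots> \<le> p (x + t *\<^sub>R y) + p (- x)" by (rule sublinear_add[OF p])
    finally show "- p (- x) \<le> p (x + t *\<^sub>R y) - t * p y" by simp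
  qed
qed (use assms in auto)

lemma le_tiltI: "(\<And>t. 0 \<le> t \<Longrightarrow> c \<le> p (x + t *\<^sub>R y) - t * p y) \<Longrightarrow> c \<le> tilt p y x"
  unfolding tilt_def by (rule cINF_greatest) auto

lemma tilt_le_self: "sublinear p \<Longrightarrow> tilt p y x \<le> p x"
  using tilt_le[of p 0 y x] by simp

lemma sublinear_tilt:
  assumes p: "sublinear p"
  shows "sublinear (tilt p y)"
proof (rule sublinearI)
  fix x x'
  have *: "tilt p y (x + x') \<le> (p (x + s *\<^sub>R y) - s * p y) + (p (x' + t *\<^sub>R y) - t * p y)"
    if "0 \<le> s" "0 \<le> t" for s t
  proof -
    have "tilt p y (x + x') \<le> p (x + x' + (s + t) *\<^sub>R y) - (s + t) * p y"
      using that by (intro tilt_le[OF p]) simp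
    also have "x + x' + (s + t) *\<^sub>R y = (x + s *\<^sub>R y) + (x' + t *\<^sub>R y)"
      by (simp add: scaleR_add_left)
    also have "p \<dots> \<le> p (x + s *\<^sub>R y) + p (x' + t *\<^sub>R y)"
      by (rule sublinear_add[OF p])
    finally show ?thesis by (simp add: algebra_simps)
  qed
  have "tilt p y (x + x') - (p (x + s *\<^sub>R y) - s * p y) \<le> tilt p y x'" if "0 \<le> s" for s
    by (rule le_tiltI) (use *[OF that] in \<open>simp add: algebra_simps\<close>)
  then have "tilt p y (x + x') - tilt p y x' \<le> tilt p y x"
    by (intro le_tiltI) (simp add: algebra_simps)
  then show "tilt p y (x + x') \<le> tilt p y x + tilt p y x'" by simp
next
  have "0 \<le> tilt p y 0" by (rule le_tiltI) (simp add: sublinear_scaleR[OF p])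
  then show "tilt p y 0 = 0" using tilt_le_self[OF p, of y 0] sublinear_0[OF p] by simp
next
  fix r :: real and x assume r: "0 < r"
  have "inverse r * tilt p y (r *\<^sub>R x) \<le> tilt p y x"
  proof (rule le_tiltI)
    fix t :: real assume t: "0 \<le> t"
    have "tilt p y (r *\<^sub>R x) \<le> p (r *\<^sub>R x + (r * t) *\<^sub>R y) - (r * t) * p y"
      using r t by (intro tilt_le[OF p]) simp
    also have "r *\<^sub>R x + (r * t) *\<^sub>R y = r *\<^sub>R (x + t *\<^sub>R y)" by (simp add: scaleR_add_right)
    also have "p \<dots> = r * p (x + t *\<^sub>R y)" using r by (simp add: sublinear_scaleR[OF p])
    finally show "inverse r * tilt p y (r *\<^sub>R x) \<le> p (x + t *\<^sub>R y) - t * p y"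
      using r by (simp add: field_simps)
  qed
  then show "tilt p y (r *\<^sub>R x) \<le> r * tilt p y x" using r by (simp add: field_simps)
qed

text \<open>The Hahn-Banach theorem in the form without a subspace: Zorn's lemma gives a minimal sublinear
  functional below \<open>q\<close>, and minimality forces linearity by tilting. A lower bound of a chain is its
  pointwise infimum, which is finite because \<open>- q (- x)\<close> bounds every sublinear functional below \<open>q\<close>.\<close>

lemma ex_linear_le_sublinear:
  fixes q :: "'a::real_vector \<Rightarrow> real"
  assumes q: "sublinear q"
  obtains p where "linear p" "\<And>x. p x \<le> q x"
proof -
  define S where "S = {p. sublinear p \<and> p \<le> q}"
  have "\<exists>p\<in>S. \<forall>p'\<in>S. p' \<le> p \<longrightarrow> p' = p"
  proof (rule predicate_Zorn)
    show "partial_order_on S (relation_of (\<lambda>p p'. p' \<le> p) S)"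
      by (rule partial_order_on_relation_ofI) auto
  next
    fix C assume "C \<in> Chains (relation_of (\<lambda>p p'. p' \<le> p) S)"
    then have C: "C \<subseteq> S" and chain: "\<And>p p'. p \<in> C \<Longrightarrow> p' \<in> C \<Longrightarrow> p \<le> p' \<or> p' \<le> p"
      by (auto simp: Chains_def relation_of_def)
    show "\<exists>u\<in>S. \<forall>p\<in>C. u \<le> p"
    proof (cases "C = {}")
      case True
      then show ?thesis using q by (auto simp: S_def)
    next
      case False
      define i where "i x = (INF p\<in>C. p x)" for x
      have bdd: "bdd_below ((\<lambda>p. p x) ` C)" for x
        using C by (intro bdd_belowI2[of _ "- q (- x)"] sublinear_lower) (auto simp: S_def le_fun_def)
      have i_le: "i x \<le> p x" if "p \<in> C" for p x
        unfolding i_def by (rule cINF_lower[OF bdd that])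
      have le_i: "c \<le> i x" if "\<And>p. p \<in> C \<Longrightarrow> c \<le> p x" for c x
        unfolding i_def by (rule cINF_greatest[OF False that])
      have sub: "sublinear p" if "p \<in> C" for p using C that by (auto simp: S_def)
      have "sublinear i"
      proof (rule sublinearI)
        fix x y
        \<comment> \<open>Subadditivity of the infimum uses the chain property: the smaller of \<open>p\<close> and \<open>p'\<close> serves both arguments.\<close>
        have *: "i (x + y) \<le> p x + p' y" if pC: "p \<in> C" "p' \<in> C" for p p'
        proof -
          obtain p'' where "p'' \<in> C" "p'' \<le> p" "p'' \<le> p'"
            using chain[OF pC] pC by blast
          then have "i (x + y) \<le> p'' (x + y)" "p'' x \<le> p x" "p'' y \<le> p' y"
            by (auto intro: i_le simp: le_fun_def)
          then show ?thesis using sublinear_add[OF sub[OF \<open>p'' \<in> C\<close>], of x y] by linarith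
        qed
        have "i (x + y) - p x \<le> i y" if "p \<in> C" for p
          by (rule le_i) (use *[OF that] in \<open>simp add: algebra_simps\<close>)
        then have "i (x + y) - i y \<le> i x" by (intro le_i) (simp add: algebra_simps)
        then show "i (x + y) \<le> i x + i y" by simp
      next
        show "i 0 = 0" using False sub by (simp add: i_def sublinear_0 cong: INF_cong)
      next
        fix r :: real and x assume r: "0 < r"
        have "inverse r * i (r *\<^sub>R x) \<le> i x"
        proof (rule le_i)
          fix p assume "p \<in> C"
          then have "i (r *\<^sub>R x) \<le> r * p x" using i_le[of p "r *\<^sub>R x"] sublinear_scaleR[OF sub] r by simp
          then show "inverse r * i (r *\<^sub>R x) \<le> p x" using r by (simp add: field_simps)
        qed
        then show "i (r *\<^sub>R x) \<le> r * i x" using r by (simp add: field_simps)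
      qed
      moreover have "i \<le> q"
        using False i_le C unfolding S_def le_fun_def by (blast intro: order_trans)
      ultimately show ?thesis using i_le by (auto simp: S_def le_fun_def)
    qed
  qed
  then obtain p where p: "sublinear p" "p \<le> q"
    and minimal: "\<And>p'. sublinear p' \<Longrightarrow> p' \<le> p \<Longrightarrow> p' = p"
    unfolding S_def by (blast intro: order_trans)
  have "p (x + y) = p x + p y" for x y
  proof (rule antisym)
    have "tilt p y = p"
      by (rule minimal) (auto simp: le_fun_def intro: sublinear_tilt tilt_le_self p)
    then have "p x \<le> p (x + 1 *\<^sub>R y) - 1 * p y" using tilt_le[OF p(1), of 1 y x] by simp
    then show "p x + p y \<le> p (x + y)" by simp
  qed (rule sublinear_add[OF p(1)])
  note add = this
  have "p (- x) = - p x" for x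
    using add[of x "- x"] sublinear_0[OF p(1)] by simp
  moreover have "p (r *\<^sub>R x) = r * p x" if "0 \<le> r" for r x
    using p(1) that by (rule sublinear_scaleR)
  ultimately have "p (r *\<^sub>R x) = r * p x" for r x
    by (cases "0 \<le> r") (metis add.inverse_inverse linear minus_mult_left neg_le_0_iff_le scaleR_minus_left)+
  with add have "linear p" by (intro linearI) auto
  with p(2) that show ?thesis by (auto simp: le_fun_def)
qed

lemma scaleC_bounded_linear: "bounded_linear (\<lambda>x::'x::complex_normed_vector. c *\<^sub>C x)"
proof (rule bounded_linear_intro[where K = "cmod c"])
  show "c *\<^sub>C (r *\<^sub>R x) = r *\<^sub>R (c *\<^sub>C x)" for r and x :: 'x
    by (metis mult.commute scaleC_of_real scaleC_scaleC)
qed (auto simp: scaleC_add_right norm_scaleC)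

lemma dual_space_separates:
  fixes x :: "'x::complex_normed_vector"
  assumes "x \<noteq> 0"
  obtains \<phi> where "\<phi> \<in> dual_space" "\<phi> x \<noteq> 0"
proof -
  obtain p where p: "linear p" "\<And>z. p z \<le> tilt norm x z"
    using ex_linear_le_sublinear[OF sublinear_tilt[OF sublinear_norm]] by blast
  have "p (- x) \<le> - norm x"
    using p(2)[of "- x"] tilt_le[OF sublinear_norm, of 1 x "- x"] by simp
  then have px: "p x \<noteq> 0" using assms linear_neg[OF p(1), of x] by auto
  have "p z \<le> norm z" for z
    using p(2)[of z] tilt_le_self[OF sublinear_norm, of x z] by simp
  then have abs_p: "norm (p z) \<le> norm z" for z
    using linear_neg[OF p(1), of z] by (metis abs_le_iff norm_minus_cancel real_norm_def)
  have "bounded_linear p"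
    by (rule bounded_linear_intro[where K = 1])
       (use p(1) abs_p in \<open>auto simp: linear_add linear_scale\<close>)
  \<comment> \<open>the complex-linear functional whose real part is \<open>p\<close>\<close>
  define \<phi> where "\<phi> z = Complex (p z) (- p (\<i> *\<^sub>C z))" for z
  have \<phi>_eq: "\<phi> = (\<lambda>z. complex_of_real (p z) - \<i> * complex_of_real (p (\<i> *\<^sub>C z)))"
    by (auto simp: \<phi>_def complex_eq_iff)
  have p_add: "p (y + z) = p y + p z" for y z using p(1) by (rule linear_add)
  have "bounded_linear \<phi>"
    unfolding \<phi>_eq
    by (intro bounded_linear_sub bounded_linear_const_mult bounded_linear_compose[OF bounded_linear_of_real]
        \<open>bounded_linear p\<close> bounded_linear_compose[OF \<open>bounded_linear p\<close> scaleC_bounded_linear])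
  moreover have "\<phi> (c *\<^sub>C z) = c * \<phi> z" for c z
  proof -
    have cz: "(complex_of_real r * d) *\<^sub>C z = r *\<^sub>R (d *\<^sub>C z)" for r d
      by (simp add: scaleC_of_real[symmetric] scaleC_scaleC)
    have 1: "c *\<^sub>C z = Re c *\<^sub>R z + Im c *\<^sub>R (\<i> *\<^sub>C z)"
      by (metis cz complex_eq mult.commute scaleC_add_left scaleC_of_real)
    have "\<i> * c = complex_of_real (Re c) * \<i> + complex_of_real (- Im c)"
      by (simp add: complex_eq_iff)
    then have 2: "\<i> *\<^sub>C (c *\<^sub>C z) = Re c *\<^sub>R (\<i> *\<^sub>C z) + (- Im c) *\<^sub>R z"
      by (simp only: scaleC_scaleC scaleC_add_left cz scaleC_of_real)
    have "p (c *\<^sub>C z) = Re c * p z + Im c * p (\<i> *\<^sub>C z)"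
      unfolding 1 by (simp add: p_add linear_scale[OF p(1)])
    moreover have "p (\<i> *\<^sub>C (c *\<^sub>C z)) = Re c * p (\<i> *\<^sub>C z) - Im c * p z"
      unfolding 2 p_add linear_scale[OF p(1)] by simp
    ultimately show ?thesis by (simp add: \<phi>_def complex_eq_iff)
  qed
  ultimately have "\<phi> \<in> dual_space" by (simp add: dual_space_def)
  moreover have "\<phi> x \<noteq> 0" using px by (simp add: \<phi>_def complex_eq_iff)
  ultimately show ?thesis by (rule that)
qed

lemma dual_space_bounded_linear: "\<phi> \<in> dual_space \<Longrightarrow> bounded_linear \<phi>"
  and dual_space_scaleC: "\<phi> \<in> dual_space \<Longrightarrow> \<phi> (c *\<^sub>C x) = c * \<phi> x"
  by (auto simp: dual_space_def)

lemma dual_space_eqI: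
  assumes "\<And>\<phi>. \<phi> \<in> dual_space \<Longrightarrow> \<phi> x = \<phi> y"
  shows "x = y"
proof (rule ccontr)
  assume "x \<noteq> y"
  then obtain \<phi> where "\<phi> \<in> dual_space" "\<phi> (x - y) \<noteq> 0"
    using dual_space_separates[of "x - y"] by auto
  then show False
    using assms[of \<phi>] linear_diff[OF bounded_linear.linear[OF dual_space_bounded_linear], of \<phi> x y]
    by simp
qed

section \<open>Vector measures have bounded range\<close>

lemma space_borel_algebra: "space (borel_algebra T) = topspace T"
  by (simp add: borel_algebra_def space_measure_of_conv)

lemma sets_borel_algebra: "sets (borel_algebra T) = sigma_sets (topspace T) {U. openin T U}"
  unfolding borel_algebra_def by (rule sets_measure_of) (auto dest: openin_subset)

lemma openin_sets_borel_algebra: "openin T U \<Longrightarrow> U \<in> sets (borel_algebra T)"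
  by (auto simp: sets_borel_algebra)

lemma topspace_sets_borel_algebra [simp]: "topspace T \<in> sets (borel_algebra T)"
  by (simp add: openin_sets_borel_algebra)

lemma closedin_sets_borel_algebra: "closedin T F \<Longrightarrow> F \<in> sets (borel_algebra T)"
  using sets.compl_sets[OF openin_sets_borel_algebra, of T "topspace T - F"]
  by (simp add: closedin_def space_borel_algebra double_diff)

lemma sets_borel_algebra_subset: "A \<in> sets (borel_algebra T) \<Longrightarrow> A \<subseteq> topspace T"
  using sets.sets_into_space[of A "borel_algebra T"] by (simp add: space_borel_algebra)

lemma vector_measure_sums:
  assumes "vector_measure T \<nu>" "\<And>n. A n \<in> sets (borel_algebra T)" "disjoint_family A"
  shows "(\<lambda>n. \<nu> (A n)) sums \<nu> (\<Union>n. A n)"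
  using assms by (auto simp: vector_measure_def image_subset_iff)

lemma vector_measure_empty:
  assumes "vector_measure T \<nu>"
  shows "\<nu> {} = 0"
proof -
  have "summable (\<lambda>_::nat. \<nu> {})"
    using vector_measure_sums[OF assms, of "\<lambda>_. {}"]
    by (auto simp: disjoint_family_on_def dest!: sums_summable)
  then show ?thesis by (auto dest!: summable_LIMSEQ_zero simp: LIMSEQ_const_iff)
qed

lemma vector_measure_Un:
  assumes "vector_measure T \<nu>" "A \<in> sets (borel_algebra T)" "B \<in> sets (borel_algebra T)" "A \<inter> B = {}"
  shows "\<nu> (A \<union> B) = \<nu> A + \<nu> B"
proof -
  have "(\<lambda>n. \<nu> (binaryset A B n)) sums \<nu> (\<Union>n. binaryset A B n)"
    using assms(2-4)
    by (intro vector_measure_sums[OF assms(1)])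
       (auto simp: binaryset_def disjoint_family_on_def)
  moreover have "(\<lambda>n. \<nu> (binaryset A B n)) sums (\<nu> A + \<nu> B)"
    by (rule binaryset_sums) (rule vector_measure_empty[OF assms(1)])
  ultimately show ?thesis by (simp add: UN_binaryset_eq sums_unique2)
qed

lemma vector_measure_Diff:
  assumes "vector_measure T \<nu>" "A \<in> sets (borel_algebra T)" "B \<in> sets (borel_algebra T)" "B \<subseteq> A"
  shows "\<nu> (A - B) = \<nu> A - \<nu> B"
  using vector_measure_Un[OF assms(1), of B "A - B"] assms(2-4)
  by (simp add: Un_absorb1)

lemma vector_measure_split:
  assumes "vector_measure T \<nu>" "A \<in> sets (borel_algebra T)" "B \<in> sets (borel_algebra T)"
  shows "\<nu> A = \<nu> (A \<inter> B) + \<nu> (A - B)"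
  using vector_measure_Un[OF assms(1), of "A \<inter> B" "A - B"] assms(2-3) by (auto simp: Int_Diff_Un)

lemma vector_measure_UN_lessThan:
  fixes A :: "nat \<Rightarrow> 'g set"
  assumes \<nu>: "vector_measure T \<nu>" and A: "\<And>n. A n \<in> sets (borel_algebra T)" "disjoint_family A"
  shows "\<nu> (\<Union>n<N. A n) = (\<Sum>n<N. \<nu> (A n))"
proof (induction N)
  case 0
  then show ?case by (simp add: vector_measure_empty[OF \<nu>])
next
  case (Suc N)
  have "A n \<inter> A N = {}" if "n < N" for n
    using disjoint_family_onD[OF A(2), of n N] that by simp
  then have "(\<Union>n<N. A n) \<inter> A N = {}" by auto
  then have "\<nu> ((\<Union>n<N. A n) \<union> A N) = \<nu> (\<Union>n<N. A n) + \<nu> (A N)"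
    using A(1) by (intro vector_measure_Un[OF \<nu>]) auto
  moreover have "(\<Union>n<N. A n) \<union> A N = (\<Union>n<Suc N. A n)" by (auto simp: lessThan_Suc)
  ultimately show ?case by (simp add: Suc.IH)
qed

lemma vector_measure_bounded_linear:
  assumes "vector_measure T \<nu>" "bounded_linear f"
  shows "vector_measure T (\<lambda>A. f (\<nu> A))"
  unfolding vector_measure_def
proof (intro allI impI)
  fix A :: "nat \<Rightarrow> 'a set"
  assume "range A \<subseteq> sets (borel_algebra T)" "disjoint_family A"
  then show "(\<lambda>n. f (\<nu> (A n))) sums f (\<nu> (\<Union>n. A n))"
    using assms by (intro bounded_linear.sums[OF assms(2)]) (auto simp: vector_measure_def)
qed

text \<open>If the range over the subsets of \<open>E\<close> is unbounded, then \<open>E\<close> splits into two parts, both of norm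
  greater than \<open>1\<close>, one of which again has unbounded range. Iterating on that part, the discarded
  parts form a disjoint sequence on which \<open>\<nu>\<close> does not tend to \<open>0\<close>, contradicting countable
  additivity. No functionals are involved, so the argument serves real, complex and vector measures
  alike.\<close>

lemma vector_measure_bounded:
  fixes \<nu> :: "'g set \<Rightarrow> 'x::real_normed_vector"
  assumes \<nu>: "vector_measure T \<nu>"
  obtains M where "\<And>A. A \<in> sets (borel_algebra T) \<Longrightarrow> norm (\<nu> A) \<le> M"
proof -
  let ?\<B> = "sets (borel_algebra T)"
  define unb where
    "unb E \<longleftrightarrow> E \<in> ?\<B> \<and> (\<forall>M. \<exists>B\<in>?\<B>. B \<subseteq> E \<and> norm (\<nu> B) > M)" for E
  have "\<exists>E'. unb E' \<and> E' \<subseteq> E \<and> 1 < norm (\<nu> (E - E'))" if E: "unb E" for E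
  proof -
    obtain A where A: "A \<in> ?\<B>" "A \<subseteq> E" "norm (\<nu> A) > norm (\<nu> E) + 1"
      using E unfolding unb_def by blast
    have EB: "E \<in> ?\<B>" using E by (simp add: unb_def)
    have "norm (\<nu> A) - norm (\<nu> E) \<le> norm (\<nu> (E - A))"
      unfolding vector_measure_Diff[OF \<nu> EB A(1,2)] by norm
    then have large: "1 < norm (\<nu> (E - A))" "1 < norm (\<nu> A)" using A(3) norm_ge_zero[of "\<nu> E"] by linarith+
    consider "unb A" | "unb (E - A)"
    proof (rule ccontr)
      assume "\<not> thesis"
      then have "\<not> unb A" "\<not> unb (E - A)" using that by auto
      then obtain M1 M2 where
        M: "\<And>B. B \<in> ?\<B> \<Longrightarrow> B \<subseteq> A \<Longrightarrow> norm (\<nu> B) \<le> M1" "\<And>B. B \<in> ?\<B> \<Longrightarrow> B \<subseteq> E - A \<Longrightarrow> norm (\<nu> B) \<le> M2"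
        using A EB unfolding unb_def by (metis linorder_not_less sets.Diff)
      obtain B where B: "B \<in> ?\<B>" "B \<subseteq> E" "norm (\<nu> B) > M1 + M2" using E unfolding unb_def by blast
      have "\<nu> B = \<nu> (B \<inter> A) + \<nu> (B - A)" by (rule vector_measure_split[OF \<nu> B(1) A(1)])
      moreover have "norm (\<nu> (B \<inter> A)) \<le> M1" "norm (\<nu> (B - A)) \<le> M2"
        using A B by (auto intro!: M)
      ultimately show False
        using B(3) norm_triangle_ineq[of "\<nu> (B \<inter> A)" "\<nu> (B - A)"] by simp
    qed
    then show ?thesis
    proof cases
      case 1
      then show ?thesis using A large by blast
    next
      case 2
      moreover have "E - (E - A) = A" using A by auto
      ultimately show ?thesis using large by (intro exI[of _ "E - A"]) auto
    qed
  qed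
  note step = this
  have "\<not> unb (topspace T)"
  proof
    assume "unb (topspace T)"
    then obtain E where E: "\<And>n. unb (E n)" "\<And>n. E (Suc n) \<subseteq> E n" "\<And>n. 1 < norm (\<nu> (E n - E (Suc n)))"
      using dependent_nat_choice[of "\<lambda>_. unb" "\<lambda>_ A B. B \<subseteq> A \<and> 1 < norm (\<nu> (A - B))"] step
      by metis
    have "decseq E" using E(2) by (rule decseq_SucI)
    have "disjoint_family (\<lambda>n. E n - E (Suc n))"
      unfolding disjoint_family_on_def
    proof (intro ballI impI)
      have *: "(E m - E (Suc m)) \<inter> (E n - E (Suc n)) = {}" if "m < n" for m n
        using decseqD[OF \<open>decseq E\<close>, of "Suc m" n] that by auto
      show "(E m - E (Suc m)) \<inter> (E n - E (Suc n)) = {}" if "m \<noteq> n" for m n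
        using that *[of m n] *[of n m] by (cases "m < n") auto
    qed
    moreover have "E n - E (Suc n) \<in> ?\<B>" for n using E(1) by (auto simp: unb_def)
    ultimately have "(\<lambda>n. \<nu> (E n - E (Suc n))) \<longlonglongrightarrow> 0"
      by (intro summable_LIMSEQ_zero sums_summable[OF vector_measure_sums[OF \<nu>]])
    then have "\<forall>\<^sub>F n in sequentially. norm (\<nu> (E n - E (Suc n))) < 1"
      by (auto dest!: tendstoD[where e = 1])
    then show False using E(3) by (auto simp: eventually_sequentially intro: less_asym)
  qed
  then show ?thesis
    using that sets_borel_algebra_subset unfolding unb_def by (metis linorder_not_less topspace_sets_borel_algebra)
qed

section \<open>The Jordan decomposition\<close>

lemma sets_positive_variation [measurable_cong, simp]:
  "sets (positive_variation T \<rho>) = sets (borel_algebra T)"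
  unfolding positive_variation_def
  by (metis sets.sigma_sets_eq sets.space_closed sets_measure_of space_borel_algebra)

lemma space_positive_variation [simp]: "space (positive_variation T \<rho>) = topspace T"
  using sets_eq_imp_space_eq[OF sets_positive_variation] by (simp add: space_borel_algebra)

text \<open>The defining supremum is itself countably additive, so the measure constructed from it takes
  these values rather than collapsing to the zero measure. It is superadditive since subsets of
  disjoint sets can be joined, and countably subadditive since a subset of a disjoint union is cut
  into its pieces.\<close>

lemma emeasure_positive_variation:
  assumes \<rho>: "vector_measure T \<rho>" and A: "A \<in> sets (borel_algebra T)"
  shows "emeasure (positive_variation T \<rho>) A =
    (SUP B\<in>{B \<in> sets (borel_algebra T). B \<subseteq> A}. ennreal (\<rho> B))"
proof -
  let ?\<B> = "sets (borel_algebra T)"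
  define v where "v A = (SUP B\<in>{B \<in> ?\<B>. B \<subseteq> A}. ennreal (\<rho> B))" for A
  have v_upper: "ennreal (\<rho> B) \<le> v A" if "B \<in> ?\<B>" "B \<subseteq> A" for A B
    unfolding v_def using that by (intro SUP_upper) auto
  have v_mono: "v A \<le> v B" if "A \<subseteq> B" for A B
    unfolding v_def using that by (intro SUP_subset_mono) auto
  have v_Un: "v A + v B \<le> v (A \<union> B)" if "A \<inter> B = {}" for A B
  proof -
    have "v A + v B = (SUP C\<in>{C \<in> ?\<B>. C \<subseteq> A}. ennreal (\<rho> C) + v B)"
      unfolding v_def[of A] by (rule ennreal_SUP_add_left[symmetric]) auto
    also have "\<dots> = (SUP C\<in>{C \<in> ?\<B>. C \<subseteq> A}. SUP D\<in>{D \<in> ?\<B>. D \<subseteq> B}. ennreal (\<rho> C) + ennreal (\<rho> D))"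
    proof (rule SUP_cong[OF refl])
      fix C
      have "(SUP D\<in>{D \<in> ?\<B>. D \<subseteq> B}. ennreal (\<rho> D) + ennreal (\<rho> C)) = v B + ennreal (\<rho> C)"
        unfolding v_def by (rule ennreal_SUP_add_left) auto
      then show "ennreal (\<rho> C) + v B = (SUP D\<in>{D \<in> ?\<B>. D \<subseteq> B}. ennreal (\<rho> C) + ennreal (\<rho> D))"
        by (simp only: add.commute)
    qed
    also have "\<dots> \<le> v (A \<union> B)"
    proof (intro SUP_least)
      fix C D assume "C \<in> {C \<in> ?\<B>. C \<subseteq> A}" "D \<in> {D \<in> ?\<B>. D \<subseteq> B}"
      then have CD: "C \<in> ?\<B>" "D \<in> ?\<B>" "C \<subseteq> A" "D \<subseteq> B" by auto
      \<comment> \<open>A set of negative \<open>\<rho>\<close> contributes \<open>0\<close> after truncation and is replaced by the empty set.\<close>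
      consider "\<rho> C \<le> 0" | "\<rho> D \<le> 0" | "0 \<le> \<rho> C" "0 \<le> \<rho> D" by linarith
      then show "ennreal (\<rho> C) + ennreal (\<rho> D) \<le> v (A \<union> B)"
      proof cases
        case 1
        then show ?thesis using v_upper[of D "A \<union> B"] CD by (auto simp: ennreal_neg)
      next
        case 2
        then show ?thesis using v_upper[of C "A \<union> B"] CD by (auto simp: ennreal_neg)
      next
        case 3
        have "\<rho> (C \<union> D) = \<rho> C + \<rho> D" using CD that by (intro vector_measure_Un[OF \<rho>]) auto
        then show ?thesis using 3 v_upper[of "C \<union> D" "A \<union> B"] CD by (auto simp: ennreal_plus)
      qed
    qed
    finally show ?thesis .
  qed
  have v_empty: "v {} = 0"
    unfolding v_def using vector_measure_empty[OF \<rho>] by (auto simp: SUP_eq_iff intro!: SUP_eq_const)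
  have "emeasure (positive_variation T \<rho>) A = v A"
  proof (rule emeasure_measure_of[of "positive_variation T \<rho>" "topspace T" ?\<B> v])
    show "positive_variation T \<rho> = measure_of (topspace T) ?\<B> v"
      by (simp only: positive_variation_def v_def[abs_def])
    show "?\<B> \<subseteq> Pow (topspace T)" using sets_borel_algebra_subset by auto
    show "positive (sets (positive_variation T \<rho>)) v" by (simp add: positive_def v_empty)
    show "A \<in> sets (positive_variation T \<rho>)" using A by simp
    show "countably_additive (sets (positive_variation T \<rho>)) v"
      unfolding countably_additive_def
    proof (intro allI impI)
      fix E :: "nat \<Rightarrow> 'a set"
      assume "range E \<subseteq> sets (positive_variation T \<rho>)" "disjoint_family E"
      then have E: "\<And>n. E n \<in> ?\<B>" "disjoint_family E" by auto
      show "(\<Sum>n. v (E n)) = v (\<Union>n. E n)"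
      proof (rule antisym)
        have "(\<Sum>n<N. v (E n)) \<le> v (\<Union>n<N. E n)" for N
        proof (induction N)
          case (Suc N)
          have "E n \<inter> E N = {}" if "n < N" for n
            using disjoint_family_onD[OF E(2), of n N] that by simp
          then have "(\<Union>n<N. E n) \<inter> E N = {}" by auto
          then have "v (\<Union>n<N. E n) + v (E N) \<le> v ((\<Union>n<N. E n) \<union> E N)" by (rule v_Un)
          moreover have "(\<Union>n<N. E n) \<union> E N = (\<Union>n<Suc N. E n)" by (auto simp: lessThan_Suc)
          ultimately have "v (\<Union>n<N. E n) + v (E N) \<le> v (\<Union>n<Suc N. E n)" by (simp only:)
          with add_right_mono[OF Suc] show ?case
            unfolding sum.lessThan_Suc by (rule order_trans)
        qed (simp add: v_empty)
        also have "v (\<Union>n<N. E n) \<le> v (\<Union>n. E n)" for N by (rule v_mono) auto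
        finally show "(\<Sum>n. v (E n)) \<le> v (\<Union>n. E n)" 
          by (intro suminf_le_const summableI)
      next
        show "v (\<Union>n. E n) \<le> (\<Sum>n. v (E n))"
          unfolding v_def[of "\<Union>n. E n"]
        proof (rule SUP_least)
          fix B assume "B \<in> {B \<in> ?\<B>. B \<subseteq> (\<Union>n. E n)}"
          then have B: "B \<in> ?\<B>" "B = (\<Union>n. E n \<inter> B)" by auto
          have "(\<lambda>n. \<rho> (E n \<inter> B)) sums \<rho> (\<Union>n. E n \<inter> B)"
            using E B by (intro vector_measure_sums[OF \<rho>]) (auto simp: disjoint_family_on_def)
          then have "(\<lambda>N. ennreal (\<Sum>n<N. \<rho> (E n \<inter> B))) \<longlonglongrightarrow> ennreal (\<rho> B)"
            unfolding sums_def B(2)[symmetric] by (rule tendsto_ennrealI)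
          moreover have "ennreal (\<Sum>n<N. \<rho> (E n \<inter> B)) \<le> (\<Sum>n. v (E n))" for N
          proof -
            have "ennreal (\<Sum>n<N. \<rho> (E n \<inter> B)) \<le> ennreal (\<Sum>n<N. max 0 (\<rho> (E n \<inter> B)))"
              by (intro ennreal_leI sum_mono) auto
            also have "\<dots> = (\<Sum>n<N. ennreal (max 0 (\<rho> (E n \<inter> B))))"
              by (rule sum_ennreal[symmetric]) simp
            also have "\<dots> = (\<Sum>n<N. ennreal (\<rho> (E n \<inter> B)))"
              by (intro sum.cong refl) (auto simp: max_def ennreal_neg)
            also have "\<dots> \<le> (\<Sum>n<N. v (E n))"
              using E B by (intro sum_mono v_upper) auto
            also have "\<dots> \<le> (\<Sum>n. v (E n))" by (rule sum_le_suminf) auto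
            finally show ?thesis .
          qed
          ultimately show "ennreal (\<rho> B) \<le> (\<Sum>n. v (E n))"
            by (intro LIMSEQ_le_const2) auto
        qed
      qed
    qed
  qed
  then show ?thesis by (simp add: v_def)
qed

lemma finite_measure_positive_variation:
  assumes \<rho>: "vector_measure T \<rho>"
  shows "finite_measure (positive_variation T \<rho>)"
proof
  obtain M where M: "\<And>A. A \<in> sets (borel_algebra T) \<Longrightarrow> norm (\<rho> A) \<le> M"
    using vector_measure_bounded[OF \<rho>] by blast
  have "emeasure (positive_variation T \<rho>) (topspace T) \<le> ennreal M"
    unfolding emeasure_positive_variation[OF \<rho> topspace_sets_borel_algebra]
    using M by (intro SUP_least ennreal_leI) (auto simp: abs_le_iff)
  then show "emeasure (positive_variation T \<rho>) (space (positive_variation T \<rho>)) \<noteq> \<infinity>"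
    by (auto simp: top_unique)
qed

lemma vector_measure_minus:
  "vector_measure T \<rho> \<Longrightarrow> vector_measure T (\<lambda>A. - \<rho> A)"
  by (auto simp: vector_measure_def intro: sums_minus)

text \<open>As \<open>\<rho> B = \<rho> A - \<rho> (A - B)\<close> for \<open>B \<subseteq> A\<close>, the supremum of \<open>\<rho>\<close> over the subsets of \<open>A\<close> is \<open>\<rho> A\<close> plus the
  supremum of \<open>- \<rho>\<close> over them.\<close>

lemma Jordan_decomposition:
  fixes \<rho> :: "'g set \<Rightarrow> real"
  assumes \<rho>: "vector_measure T \<rho>" and A: "A \<in> sets (borel_algebra T)"
  shows "\<rho> A = measure (positive_variation T \<rho>) A - measure (positive_variation T (\<lambda>A. - \<rho> A)) A"
proof -
  let ?\<B> = "sets (borel_algebra T)"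
  have upper: "\<rho> B \<le> measure (positive_variation T \<rho>) A" if \<rho>: "vector_measure T \<rho>" "B \<in> ?\<B>" "B \<subseteq> A" for B \<rho>
  proof -
    interpret finite_measure "positive_variation T \<rho>" using \<rho>(1) by (rule finite_measure_positive_variation)
    have "ennreal (\<rho> B) \<le> ennreal (measure (positive_variation T \<rho>) A)"
      unfolding emeasure_eq_measure[symmetric] emeasure_positive_variation[OF \<rho>(1) A]
      using that by (intro SUP_upper) auto
    then show ?thesis by (simp add: ennreal_le_iff2) (meson measure_nonneg order_trans)
  qed
  have least: "measure (positive_variation T \<rho>) A \<le> c"
    if \<rho>: "vector_measure T \<rho>" and c: "\<And>B. B \<in> ?\<B> \<Longrightarrow> B \<subseteq> A \<Longrightarrow> \<rho> B \<le> c" for c \<rho>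
  proof -
    interpret finite_measure "positive_variation T \<rho>" using \<rho>(1) by (rule finite_measure_positive_variation)
    have "0 \<le> c" using c[of "{}"] vector_measure_empty[OF \<rho>] by simp
    have "ennreal (measure (positive_variation T \<rho>) A) \<le> ennreal c"
      unfolding emeasure_eq_measure[symmetric] emeasure_positive_variation[OF \<rho> A]
      using c by (intro SUP_least ennreal_leI) auto
    with \<open>0 \<le> c\<close> show ?thesis by simp
  qed
  have "measure (positive_variation T \<rho>) A \<le> \<rho> A + measure (positive_variation T (\<lambda>A. - \<rho> A)) A"
  proof (rule least[OF \<rho>])
    fix B assume B: "B \<in> ?\<B>" "B \<subseteq> A"
    show "\<rho> B \<le> \<rho> A + measure (positive_variation T (\<lambda>A. - \<rho> A)) A"
      using upper[OF vector_measure_minus[OF \<rho>], of "A - B"] vector_measure_Diff[OF \<rho> A B] A B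
      by simp
  qed
  moreover have "measure (positive_variation T (\<lambda>A. - \<rho> A)) A \<le> measure (positive_variation T \<rho>) A - \<rho> A"
  proof (rule least[OF vector_measure_minus[OF \<rho>]])
    fix B assume B: "B \<in> ?\<B>" "B \<subseteq> A"
    show "- \<rho> B \<le> measure (positive_variation T \<rho>) A - \<rho> A"
      using upper[OF \<rho>, of "A - B"] vector_measure_Diff[OF \<rho> A B] A B
      by simp
  qed
  ultimately show ?thesis by simp
qed

section \<open>Integration of bounded Borel functions\<close>

definition bounded_borel :: "'g topology \<Rightarrow> ('g \<Rightarrow> complex) \<Rightarrow> bool" where
  "bounded_borel T f \<longleftrightarrow>
     f \<in> borel_measurable (borel_algebra T) \<and> (\<exists>B. \<forall>t\<in>topspace T. norm (f t) \<le> B)"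

lemma bounded_borelI:
  "f \<in> borel_measurable (borel_algebra T) \<Longrightarrow> (\<And>t. t \<in> topspace T \<Longrightarrow> norm (f t) \<le> B) \<Longrightarrow>
    bounded_borel T f"
  by (auto simp: bounded_borel_def)

lemma bounded_borel_measurable:
  "bounded_borel T f \<Longrightarrow> f \<in> borel_measurable (borel_algebra T)"
  by (simp add: bounded_borel_def)

lemma bounded_borelE:
  assumes "bounded_borel T f"
  obtains B where "0 < B" "\<And>t. t \<in> topspace T \<Longrightarrow> norm (f t) \<le> B"
proof -
  obtain B where "\<And>t. t \<in> topspace T \<Longrightarrow> norm (f t) \<le> B"
    using assms by (auto simp: bounded_borel_def)
  then have "\<And>t. t \<in> topspace T \<Longrightarrow> norm (f t) \<le> max B 1" by (meson max.coboundedI1)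
  then show ?thesis by (intro that[of "max B 1"]) auto
qed

lemma bounded_borel_add:
  assumes "bounded_borel T f" "bounded_borel T g"
  shows "bounded_borel T (\<lambda>t. f t + g t)"
proof -
  obtain B C where "\<And>t. t \<in> topspace T \<Longrightarrow> norm (f t) \<le> B" "\<And>t. t \<in> topspace T \<Longrightarrow> norm (g t) \<le> C"
    using assms by (auto simp: bounded_borel_def)
  then show ?thesis
    using assms by (intro bounded_borelI[of _ _ "B + C"] borel_measurable_add norm_triangle_mono)
      (auto simp: bounded_borel_measurable)
qed

lemma bounded_borel_cmult:
  assumes "bounded_borel T f"
  shows "bounded_borel T (\<lambda>t. c * f t)"
proof -
  obtain B where "\<And>t. t \<in> topspace T \<Longrightarrow> norm (f t) \<le> B"
    using assms by (auto simp: bounded_borel_def)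
  then show ?thesis
    using assms bounded_borel_measurable[OF assms]
    by (intro bounded_borelI[of _ _ "norm c * B"]) (auto simp: norm_mult intro: mult_left_mono)
qed

lemma bounded_borel_indicator: "A \<in> sets (borel_algebra T) \<Longrightarrow> bounded_borel T (indicator A)"
  by (rule bounded_borelI[of _ _ 1]) (auto simp: indicator_def)

lemma bounded_borel_sum:
  "(\<And>i. i \<in> I \<Longrightarrow> bounded_borel T (f i)) \<Longrightarrow> bounded_borel T (\<lambda>t. \<Sum>i\<in>I. f i t)"
  by (induction I rule: infinite_finite_induct)
     (auto intro: bounded_borel_add bounded_borelI[of "\<lambda>_. 0" _ 0])

lemma bounded_borel_cong:
  assumes "\<And>t. t \<in> topspace T \<Longrightarrow> f t = g t" "bounded_borel T f"
  shows "bounded_borel T g"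
  using assms measurable_cong[of "borel_algebra T" f g borel]
  by (auto simp: bounded_borel_def space_borel_algebra)

lemma (in finite_measure) integrable_bounded_borel:
  assumes "sets M = sets (borel_algebra T)" "bounded_borel T f"
  shows "integrable M f"
proof -
  have "space M = topspace T" using sets_eq_imp_space_eq[OF assms(1)] by (simp add: space_borel_algebra)
  then show ?thesis
    using bounded_borel_measurable[OF assms(2)] assms(2)
    unfolding measurable_cong_sets[OF assms(1) refl, symmetric]
    by (auto simp: bounded_borel_def intro!: integrable_const_bound)
qed

text \<open>The four positive parts of a complex measure are indexed by the powers of \<open>\<i>\<close>, so that
  \<open>\<mu> = (\<Sum>k<4. \<i> ^ k * jordan_part T \<mu> k)\<close>. The complex integral is then a fixed linear combination of
  four Lebesgue integrals over finite measures.\<close>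

definition jordan_part :: "'g topology \<Rightarrow> ('g set \<Rightarrow> complex) \<Rightarrow> nat \<Rightarrow> 'g measure" where
  "jordan_part T \<mu> k = positive_variation T (\<lambda>A. Re ((- \<i>) ^ k * \<mu> A))"

lemma sets_jordan_part [measurable_cong, simp]: "sets (jordan_part T \<mu> k) = sets (borel_algebra T)"
  and space_jordan_part [simp]: "space (jordan_part T \<mu> k) = topspace T"
  by (simp_all add: jordan_part_def)

lemma vector_measure_Re_rotated:
  fixes \<mu> :: "'g set \<Rightarrow> complex"
  assumes "vector_measure T \<mu>"
  shows "vector_measure T (\<lambda>A. Re (c * \<mu> A))"
  by (rule vector_measure_bounded_linear[OF assms])
     (intro bounded_linear_compose[OF bounded_linear_Re bounded_linear_mult_right])

lemma finite_measure_jordan_part: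
  "vector_measure T \<mu> \<Longrightarrow> finite_measure (jordan_part T \<mu> k)"
  unfolding jordan_part_def
  by (intro finite_measure_positive_variation vector_measure_Re_rotated)

lemma jordan_part_simps:
  "jordan_part T \<mu> 0 = positive_variation T (\<lambda>A. Re (\<mu> A))"
  "jordan_part T \<mu> 1 = positive_variation T (\<lambda>A. Im (\<mu> A))"
  "jordan_part T \<mu> 2 = positive_variation T (\<lambda>A. - Re (\<mu> A))"
  "jordan_part T \<mu> 3 = positive_variation T (\<lambda>A. - Im (\<mu> A))"
  by (simp_all add: jordan_part_def power3_eq_cube)

lemma sum_lessThan_4: "(\<Sum>k<4. h k) = h 0 + h 1 + h 2 + h 3" for h :: "nat \<Rightarrow> complex"
  by (simp add: eval_nat_numeral)

lemma complex_integral_jordan_part: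
  "complex_integral T \<mu> f = (\<Sum>k<4. \<i> ^ k * (LINT t|jordan_part T \<mu> k. f t))"
  unfolding complex_integral_def signed_integral_def sum_lessThan_4 jordan_part_simps
  by (simp add: power3_eq_cube algebra_simps)

lemma measure_jordan_part:
  fixes \<mu> :: "'g set \<Rightarrow> complex"
  assumes \<mu>: "vector_measure T \<mu>" and A: "A \<in> sets (borel_algebra T)"
  shows "\<mu> A = (\<Sum>k<4. \<i> ^ k * complex_of_real (measure (jordan_part T \<mu> k) A))"
proof -
  have "vector_measure T (\<lambda>A. Re (\<mu> A))" "vector_measure T (\<lambda>A. Im (\<mu> A))"
    using vector_measure_Re_rotated[OF \<mu>, of 1] vector_measure_Re_rotated[OF \<mu>, of "- \<i>"] by simp_all
  from this[THEN Jordan_decomposition[OF _ A]] show ?thesis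
    unfolding sum_lessThan_4 jordan_part_simps by (simp add: complex_eq_iff power3_eq_cube)
qed

text \<open>This transfers the regularity of a Radon measure to its positive parts.\<close>

lemma emeasure_jordan_part_le_total_variation:
  assumes \<mu>: "vector_measure T \<mu>" and A: "A \<in> sets (borel_algebra T)"
  shows "emeasure (jordan_part T \<mu> k) A \<le> total_variation T \<mu> A"
  unfolding jordan_part_def emeasure_positive_variation[OF vector_measure_Re_rotated[OF \<mu>] A]
proof (rule SUP_least)
  fix B assume B: "B \<in> {B \<in> sets (borel_algebra T). B \<subseteq> A}"
  have "Re ((- \<i>) ^ k * \<mu> B) \<le> cmod (\<mu> B)"
    using complex_Re_le_cmod[of "(- \<i>) ^ k * \<mu> B"] by (simp add: norm_mult norm_power)
  then have "ennreal (Re ((- \<i>) ^ k * \<mu> B)) \<le> ennreal (cmod (\<mu> B))" by (rule ennreal_leI)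
  also have "\<dots> \<le> (\<Sum>C\<in>{B, A - B}. ennreal (cmod (\<mu> C)))"
    by (rule member_le_sum) auto
  also have "\<dots> \<le> total_variation T \<mu> A"
    unfolding total_variation_def
  proof (rule SUP_upper)
    show "{B, A - B} \<in> {P. finite P \<and> P \<subseteq> sets (borel_algebra T) \<and> disjoint P \<and> \<Union>P = A}"
      using A B by (auto simp: disjoint_def)
  qed
  finally show "ennreal (Re ((- \<i>) ^ k * \<mu> B)) \<le> total_variation T \<mu> A" .
qed

lemma complex_integral_cong:
  assumes "\<And>t. t \<in> topspace T \<Longrightarrow> f t = g t"
  shows "complex_integral T \<mu> f = complex_integral T \<mu> g"
proof -
  have "(LINT t|positive_variation T \<rho>. f t) = (LINT t|positive_variation T \<rho>. g t)" for \<rho>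
    by (rule Bochner_Integration.integral_cong) (use assms in auto)
  then show ?thesis by (simp add: complex_integral_def signed_integral_def)
qed

text \<open>The values of a measure outside the Borel sets are arbitrary, and for a convolution they are
  indeed meaningless.\<close>

lemma complex_integral_cong_measure:
  assumes "\<And>A. A \<in> sets (borel_algebra T) \<Longrightarrow> \<mu> A = \<mu>' A"
  shows "complex_integral T \<mu> f = complex_integral T \<mu>' f"
proof -
  have "positive_variation T \<rho> = positive_variation T \<rho>'"
    if "\<And>A. A \<in> sets (borel_algebra T) \<Longrightarrow> \<rho> A = \<rho>' A" for \<rho> \<rho>' :: "'a set \<Rightarrow> real"
    unfolding positive_variation_def using that
    by (intro arg_cong[where f = "measure_of _ _"] ext SUP_cong) auto
  from this[of "\<lambda>A. Re (\<mu> A)" "\<lambda>A. Re (\<mu>' A)"] this[of "\<lambda>A. - Re (\<mu> A)" "\<lambda>A. - Re (\<mu>' A)"]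
    this[of "\<lambda>A. Im (\<mu> A)" "\<lambda>A. Im (\<mu>' A)"] this[of "\<lambda>A. - Im (\<mu> A)" "\<lambda>A. - Im (\<mu>' A)"]
  show ?thesis using assms by (simp add: complex_integral_def signed_integral_def)
qed

lemma complex_integral_add:
  assumes "vector_measure T \<mu>" "bounded_borel T f" "bounded_borel T g"
  shows "complex_integral T \<mu> (\<lambda>t. f t + g t) = complex_integral T \<mu> f + complex_integral T \<mu> g"
proof -
  have "integrable (jordan_part T \<mu> k) h" if "bounded_borel T h" for h k
    by (rule finite_measure.integrable_bounded_borel[OF finite_measure_jordan_part[OF assms(1)] _ that]) simp
  then show ?thesis
    using assms(2,3) by (simp add: complex_integral_jordan_part sum.distrib distrib_left)
qed

lemma complex_integral_cmult:
  "complex_integral T \<mu> (\<lambda>t. c * f t) = c * complex_integral T \<mu> f"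
  by (simp add: complex_integral_jordan_part sum_distrib_left mult.left_commute)

lemma complex_integral_zero: "complex_integral T \<mu> (\<lambda>t. 0) = 0"
  by (simp add: complex_integral_def signed_integral_def)

lemma complex_integral_sum:
  assumes "vector_measure T \<mu>" "\<And>i. i \<in> I \<Longrightarrow> bounded_borel T (f i)"
  shows "complex_integral T \<mu> (\<lambda>t. \<Sum>i\<in>I. f i t) = (\<Sum>i\<in>I. complex_integral T \<mu> (f i))"
  using assms(2)
  by (induction I rule: infinite_finite_induct)
     (auto simp: complex_integral_zero complex_integral_add[OF assms(1)] bounded_borel_sum)

lemma complex_integral_indicator:
  assumes "vector_measure T \<mu>" "A \<in> sets (borel_algebra T)"
  shows "complex_integral T \<mu> (indicator A) = \<mu> A"
proof -
  have "(LINT t|jordan_part T \<mu> k. indicator A t) = complex_of_real (measure (jordan_part T \<mu> k) A)" for k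
  proof -
    have "(LINT t|jordan_part T \<mu> k. indicator A t) = (LINT t|jordan_part T \<mu> k. complex_of_real (indicator A t))"
      by (intro Bochner_Integration.integral_cong) (auto simp: indicator_def)
    also have "\<dots> = complex_of_real (measure (jordan_part T \<mu> k) (A \<inter> space (jordan_part T \<mu> k)))"
      unfolding integral_complex_of_real by simp
    also have "A \<inter> space (jordan_part T \<mu> k) = A" using sets_borel_algebra_subset[OF assms(2)] by auto
    finally show ?thesis .
  qed
  then show ?thesis
    by (simp only: measure_jordan_part[OF assms] complex_integral_jordan_part)
qed

lemma complex_integral_bounded_convergence:
  assumes "vector_measure T \<mu>" "\<And>n. f n \<in> borel_measurable (borel_algebra T)"
    and B: "\<And>n t. t \<in> topspace T \<Longrightarrow> norm (f n t) \<le> B"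
    and lim: "\<And>t. t \<in> topspace T \<Longrightarrow> (\<lambda>n. f n t) \<longlonglongrightarrow> g t"
  shows "bounded_borel T g" "(\<lambda>n. complex_integral T \<mu> (f n)) \<longlonglongrightarrow> complex_integral T \<mu> g"
proof -
  show g: "bounded_borel T g"
  proof (rule bounded_borelI[of _ _ B])
    show "g \<in> borel_measurable (borel_algebra T)"
      by (rule borel_measurable_LIMSEQ_metric[of f, OF assms(2)]) (simp add: lim space_borel_algebra)
    show "norm (g t) \<le> B" if "t \<in> topspace T" for t
      using tendsto_norm[OF lim[OF that]] B[OF that] by (intro LIMSEQ_le_const2) auto
  qed
  have f: "bounded_borel T (f n)" for n using assms(2) B by (rule bounded_borelI)
  have "(\<lambda>n. LINT t|jordan_part T \<mu> k. f n t) \<longlonglongrightarrow> (LINT t|jordan_part T \<mu> k. g t)" for k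
  proof (rule integral_dominated_convergence[where w = "\<lambda>_. B"])
    interpret finite_measure "jordan_part T \<mu> k" by (rule finite_measure_jordan_part[OF assms(1)])
    show "integrable (jordan_part T \<mu> k) (\<lambda>_. B)" by simp
    show "g \<in> borel_measurable (jordan_part T \<mu> k)" "f n \<in> borel_measurable (jordan_part T \<mu> k)" for n
      unfolding measurable_cong_sets[OF sets_jordan_part refl]
      by (intro bounded_borel_measurable g f)+
    show "AE x in jordan_part T \<mu> k. (\<lambda>n. f n x) \<longlonglongrightarrow> g x" "AE x in jordan_part T \<mu> k. norm (f n x) \<le> B" for n
      by (auto simp: lim B)
  qed
  then show "(\<lambda>n. complex_integral T \<mu> (f n)) \<longlonglongrightarrow> complex_integral T \<mu> g"
    unfolding complex_integral_jordan_part by (intro tendsto_intros)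
qed

subsection \<open>Binary expansions\<close>

text \<open>The digits start at \<open>n = 0\<close>, which is why \<open>x\<close> ranges over \<open>[0, 2)\<close>. In this way the constant function
  \<open>1\<close> has an expansion too.\<close>

lemma binary_digits_sums:
  fixes x :: real
  assumes "0 \<le> x" "x < 2"
  shows "(\<lambda>n. (1/2) ^ n * of_bool (odd \<lfloor>2 ^ n * x\<rfloor>)) sums x"
proof -
  have partial: "(\<Sum>n<Suc N. (1/2) ^ n * of_bool (odd \<lfloor>2 ^ n * x\<rfloor>)) = (1/2) ^ N * real_of_int \<lfloor>2 ^ N * x\<rfloor>" for N
  proof (induction N)
    case 0
    have "\<lfloor>x\<rfloor> = 0 \<or> \<lfloor>x\<rfloor> = 1" using assms by linarith
    then show ?case by auto
  next
    case (Suc N)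
    have "\<lfloor>2 ^ Suc N * x\<rfloor> = 2 * \<lfloor>2 ^ N * x\<rfloor> \<or> \<lfloor>2 ^ Suc N * x\<rfloor> = 2 * \<lfloor>2 ^ N * x\<rfloor> + 1"
      by simp linarith
    then have "real_of_int \<lfloor>2 ^ Suc N * x\<rfloor> = 2 * real_of_int \<lfloor>2 ^ N * x\<rfloor> + of_bool (odd \<lfloor>2 ^ Suc N * x\<rfloor>)"
      by auto
    then show ?case unfolding sum.lessThan_Suc[of _ "Suc N"] Suc.IH by (simp add: field_simps)
  qed
  have "(\<lambda>N. (1/2) ^ N * real_of_int \<lfloor>2 ^ N * x\<rfloor>) \<longlonglongrightarrow> x"
  proof (rule tendsto_sandwich[of "\<lambda>N. x - (1/2) ^ N" _ _ "\<lambda>_. x"])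
    have "x - (1/2) ^ N \<le> (1/2) ^ N * real_of_int \<lfloor>2 ^ N * x\<rfloor>" "(1/2) ^ N * real_of_int \<lfloor>2 ^ N * x\<rfloor> \<le> x" for N
    proof -
      have *: "(1/2) ^ N * (2 ^ N * x) = x" by (simp add: power_one_over)
      have "(1/2) ^ N * (2 ^ N * x - 1) \<le> (1/2) ^ N * real_of_int \<lfloor>2 ^ N * x\<rfloor>"
        by (intro mult_left_mono) (linarith, simp)
      then show "x - (1/2) ^ N \<le> (1/2) ^ N * real_of_int \<lfloor>2 ^ N * x\<rfloor>"
        unfolding right_diff_distrib * by simp
      have "(1/2) ^ N * real_of_int \<lfloor>2 ^ N * x\<rfloor> \<le> (1/2) ^ N * (2 ^ N * x)"
        by (intro mult_left_mono) auto
      then show "(1/2) ^ N * real_of_int \<lfloor>2 ^ N * x\<rfloor> \<le> x" unfolding * .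
    qed
    then show "\<forall>\<^sub>F N in sequentially. x - (1/2) ^ N \<le> (1/2) ^ N * real_of_int \<lfloor>2 ^ N * x\<rfloor>"
      "\<forall>\<^sub>F N in sequentially. (1/2) ^ N * real_of_int \<lfloor>2 ^ N * x\<rfloor> \<le> x" by auto
    show "(\<lambda>N. x - (1/2) ^ N) \<longlonglongrightarrow> x"
      using tendsto_diff[OF tendsto_const LIMSEQ_realpow_zero[of "1/2"], of x] by simp
  qed simp
  then have "(\<lambda>N. \<Sum>n<Suc N. (1/2) ^ n * of_bool (odd \<lfloor>2 ^ n * x\<rfloor>)) \<longlonglongrightarrow> x"
    unfolding partial .
  then show ?thesis unfolding sums_def by (rule LIMSEQ_imp_Suc)
qed

text \<open>The function whose \<open>n\<close>-th binary digit is the indicator of \<open>A n\<close>. Every measurable function into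
  \<open>[0, 1]\<close> has this form, and the coefficients do not depend on the function. A uniform estimate on
  the sets \<open>A n\<close> therefore controls the integral of any such function.\<close>

definition dyadic :: "(nat \<Rightarrow> 'a set) \<Rightarrow> 'a \<Rightarrow> complex" where
  "dyadic A t = (\<Sum>n. (1/2) ^ n * indicator (A n) t)"

lemma dyadic_partial_bound: "norm (\<Sum>n<N. (1/2) ^ n * indicator (A n) t :: complex) \<le> 2"
proof -
  have "norm (\<Sum>n<N. (1/2) ^ n * indicator (A n) t :: complex) \<le> (\<Sum>n<N. (1/2) ^ n)"
    by (intro sum_norm_le) (auto simp: norm_mult norm_power indicator_def norm_divide)
  also have "\<dots> \<le> (\<Sum>n. (1/2) ^ n :: real)" by (intro sum_le_suminf) auto
  finally show ?thesis by (simp add: suminf_geometric)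
qed

lemma dyadic_sums: "(\<lambda>n. (1/2) ^ n * indicator (A n) t) sums dyadic A t"
proof -
  have "summable (\<lambda>n. (1/2) ^ n * indicator (A n) t :: complex)"
    by (rule summable_comparison_test'[of "\<lambda>n. (1/2) ^ n" 0])
       (auto simp: norm_mult norm_power indicator_def norm_divide)
  then show ?thesis unfolding dyadic_def by (rule summable_sums)
qed

lemma complex_integral_dyadic:
  assumes \<mu>: "vector_measure T \<mu>" and A: "\<And>n. A n \<in> sets (borel_algebra T)"
  shows "(\<lambda>n. (1/2) ^ n * \<mu> (A n)) sums complex_integral T \<mu> (dyadic A)"
proof -
  have bb: "bounded_borel T (\<lambda>t. (1/2) ^ n * indicator (A n) t)" for n
    by (intro bounded_borel_cmult bounded_borel_indicator A)
  have "complex_integral T \<mu> (\<lambda>t. \<Sum>n<N. (1/2) ^ n * indicator (A n) t) = (\<Sum>n<N. (1/2) ^ n * \<mu> (A n))" for N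
    by (simp only: complex_integral_sum[OF \<mu> bb] complex_integral_cmult
        complex_integral_indicator[OF \<mu> A])
  moreover have "(\<lambda>N. complex_integral T \<mu> (\<lambda>t. \<Sum>n<N. (1/2) ^ n * indicator (A n) t)) \<longlonglongrightarrow>
      complex_integral T \<mu> (dyadic A)"
  proof (rule complex_integral_bounded_convergence(2)[OF \<mu>, where B = 2])
    show "(\<lambda>t. \<Sum>n<N. (1/2) ^ n * indicator (A n) t :: complex) \<in> borel_measurable (borel_algebra T)" for N
      by (intro bounded_borel_measurable bounded_borel_sum bb)
    show "(\<lambda>N. \<Sum>n<N. (1/2) ^ n * indicator (A n) t) \<longlonglongrightarrow> dyadic A t" for t
      using dyadic_sums unfolding sums_def .
  qed (rule dyadic_partial_bound)
  ultimately show ?thesis by (simp only: sums_def)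
qed

text \<open>An induction for bounded Borel functions in which the only limits are dyadic series. In
  contrast to bounded pointwise limits, these are norm convergent for vector measures.\<close>

lemma bounded_borel_induct [consumes 1, case_names cong add cmult dyadic]:
  assumes f: "bounded_borel T f"
    and cong: "\<And>f g. (\<And>t. t \<in> topspace T \<Longrightarrow> f t = g t) \<Longrightarrow> Q f \<Longrightarrow> Q g"
    and add: "\<And>f g. bounded_borel T f \<Longrightarrow> bounded_borel T g \<Longrightarrow> Q f \<Longrightarrow> Q g \<Longrightarrow> Q (\<lambda>t. f t + g t)"
    and cmult: "\<And>c f. bounded_borel T f \<Longrightarrow> Q f \<Longrightarrow> Q (\<lambda>t. c * f t)"
    and dyadic: "\<And>A. (\<And>n. A n \<in> sets (borel_algebra T)) \<Longrightarrow> Q (dyadic A)"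
  shows "Q f"
proof -
  have *: "bounded_borel T (\<lambda>t. complex_of_real (g t)) \<and> Q (\<lambda>t. complex_of_real (g t))"
    if g: "g \<in> borel_measurable (borel_algebra T)" "\<And>t. t \<in> topspace T \<Longrightarrow> 0 \<le> g t \<and> g t \<le> 1" for g
  proof
    show "bounded_borel T (\<lambda>t. complex_of_real (g t))"
      using g by (intro bounded_borelI[of _ _ 1]) auto
    define A where "A n = {t \<in> space (borel_algebra T). odd \<lfloor>2 ^ n * g t\<rfloor>}" for n :: nat
    have "A n \<in> sets (borel_algebra T)" for n
      unfolding A_def using g(1) by measurable
    then have "Q (dyadic A)" by (rule dyadic)
    moreover have "dyadic A t = complex_of_real (g t)" if "t \<in> topspace T" for t
    proof -
      have "(\<lambda>n. (1/2) ^ n * of_bool (odd \<lfloor>2 ^ n * g t\<rfloor>)) sums g t"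
        using g(2)[OF that] by (intro binary_digits_sums) auto
      then have "(\<lambda>n. complex_of_real ((1/2) ^ n * of_bool (odd \<lfloor>2 ^ n * g t\<rfloor>))) sums complex_of_real (g t)"
        by (rule sums_of_real)
      moreover have "complex_of_real ((1/2) ^ n * of_bool (odd \<lfloor>2 ^ n * g t\<rfloor>)) = (1/2) ^ n * indicator (A n) t" for n
        using that by (simp add: A_def indicator_def space_borel_algebra)
      ultimately show ?thesis using dyadic_sums[of A t] sums_unique2 by simp
    qed
    ultimately show "Q (\<lambda>t. complex_of_real (g t))" by (rule cong[rotated])
  qed
  obtain B where B: "0 < B" "\<And>t. t \<in> topspace T \<Longrightarrow> norm (f t) \<le> B" using bounded_borelE[OF f] by blast
  have m: "f \<in> borel_measurable (borel_algebra T)" using f by (rule bounded_borel_measurable)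
  define g where "g t = (Re (f t) / B + 1) / 2" for t
  define h where "h t = (Im (f t) / B + 1) / 2" for t
  have "0 \<le> g t \<and> g t \<le> 1" "0 \<le> h t \<and> h t \<le> 1" if t: "t \<in> topspace T" for t
  proof -
    have "- B \<le> Re (f t)" "Re (f t) \<le> B" "- B \<le> Im (f t)" "Im (f t) \<le> B"
      using B(2)[OF t] abs_Re_le_cmod[of "f t"] abs_Im_le_cmod[of "f t"] by linarith+
    then show "0 \<le> g t \<and> g t \<le> 1" "0 \<le> h t \<and> h t \<le> 1"
      using B(1) by (simp_all add: g_def h_def field_simps)
  qed
  moreover have "g \<in> borel_measurable (borel_algebra T)" "h \<in> borel_measurable (borel_algebra T)"
    using m unfolding g_def h_def by measurable
  ultimately have gh: "bounded_borel T (\<lambda>t. complex_of_real (g t)) \<and> Q (\<lambda>t. complex_of_real (g t))"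
    "bounded_borel T (\<lambda>t. complex_of_real (h t)) \<and> Q (\<lambda>t. complex_of_real (h t))"
    using *[of g] *[of h] by blast+
  have one: "bounded_borel T (\<lambda>t. 1) \<and> Q (\<lambda>t. 1)" using *[of "\<lambda>_. 1"] by simp
  let ?c = "- complex_of_real B - \<i> * complex_of_real B"
  \<comment> \<open>\<open>f\<close> is recovered from the rescaled real and imaginary parts \<open>g\<close> and \<open>h\<close>, which take values in \<open>[0, 1]\<close>.\<close>
  have "Q (\<lambda>t. ((2 * complex_of_real B) * complex_of_real (g t) + (2 * \<i> * complex_of_real B) * complex_of_real (h t)) + ?c * 1)"
    using gh one by (intro add cmult bounded_borel_add bounded_borel_cmult) auto
  moreover have "((2 * complex_of_real B) * complex_of_real (g t) + (2 * \<i> * complex_of_real B) * complex_of_real (h t)) + ?c * 1 = f t" for t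
    using B(1) by (simp add: g_def h_def complex_eq_iff field_simps)
  ultimately show ?thesis by simp
qed

subsection \<open>The vector integral\<close>

lemma vector_measure_dual:
  "vector_measure T \<nu> \<Longrightarrow> \<phi> \<in> dual_space \<Longrightarrow> vector_measure T (\<lambda>A. \<phi> (\<nu> A))"
  by (rule vector_measure_bounded_linear) (auto dest: dual_space_bounded_linear)

lemma vector_integral_unique:
  assumes "\<And>\<phi>. \<phi> \<in> dual_space \<Longrightarrow> \<phi> y = complex_integral T (\<lambda>A. \<phi> (\<nu> A)) f"
  shows "vector_integral T \<nu> f = y"
  unfolding vector_integral_def
proof (rule the_equality)
  show "\<forall>\<phi>\<in>dual_space. \<phi> y = complex_integral T (\<lambda>A. \<phi> (\<nu> A)) f" using assms by blast
qed (auto intro: dual_space_eqI simp: assms)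

text \<open>The definite description defining the vector integral has a witness. For a dyadic function it is
  \<open>\<Sum>n. 2\<^sup>-\<^sup>n \<nu> (A n)\<close>, absolutely convergent as the range of \<open>\<nu>\<close> is bounded, and linear combinations of
  witnesses are witnesses.\<close>

lemma dual_vector_integral:
  fixes \<nu> :: "'g set \<Rightarrow> 'x::{complex_normed_vector, banach}"
  assumes \<nu>: "vector_measure T \<nu>" and f: "bounded_borel T f" and \<phi>: "\<phi> \<in> dual_space"
  shows "\<phi> (vector_integral T \<nu> f) = complex_integral T (\<lambda>A. \<phi> (\<nu> A)) f"
proof -
  have \<phi>\<nu>: "vector_measure T (\<lambda>A. \<phi> (\<nu> A))" if "\<phi> \<in> dual_space" for \<phi>
    using \<nu> that by (rule vector_measure_dual)
  from f have "\<exists>y. \<forall>\<phi>\<in>dual_space. \<phi> y = complex_integral T (\<lambda>A. \<phi> (\<nu> A)) f"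
  proof (induction rule: bounded_borel_induct)
    case (cong f g)
    then show ?case using complex_integral_cong[of T f g] by auto
  next
    case (add f g)
    then obtain y z where
      "\<And>\<phi>. \<phi> \<in> dual_space \<Longrightarrow> \<phi> y = complex_integral T (\<lambda>A. \<phi> (\<nu> A)) f"
      "\<And>\<phi>. \<phi> \<in> dual_space \<Longrightarrow> \<phi> z = complex_integral T (\<lambda>A. \<phi> (\<nu> A)) g" by blast
    then show ?case
      using add(1,2)
      by (intro exI[of _ "y + z"])
         (auto simp: complex_integral_add \<phi>\<nu> linear_add[OF bounded_linear.linear[OF dual_space_bounded_linear]])
  next
    case (cmult c f)
    then obtain y where
      "\<And>\<phi>. \<phi> \<in> dual_space \<Longrightarrow> \<phi> y = complex_integral T (\<lambda>A. \<phi> (\<nu> A)) f" by blast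
    then show ?case
      by (intro exI[of _ "c *\<^sub>C y"]) (auto simp: complex_integral_cmult dual_space_scaleC)
  next
    case (dyadic A)
    obtain M where M: "\<And>A. A \<in> sets (borel_algebra T) \<Longrightarrow> norm (\<nu> A) \<le> M"
      using vector_measure_bounded[OF \<nu>] by blast
    have "summable (\<lambda>n. (1/2) ^ n *\<^sub>R \<nu> (A n))"
    proof (rule summable_comparison_test'[of "\<lambda>n. (1/2) ^ n * M" 0])
      show "summable (\<lambda>n. (1/2) ^ n * M)" by (intro summable_mult2 summable_geometric) simp
      show "norm ((1/2) ^ n *\<^sub>R \<nu> (A n)) \<le> (1/2) ^ n * M" for n
        using M[OF dyadic, of n] by simp
    qed
    then have y: "(\<lambda>n. (1/2) ^ n *\<^sub>R \<nu> (A n)) sums (\<Sum>n. (1/2) ^ n *\<^sub>R \<nu> (A n))" by (rule summable_sums)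
    show ?case
    proof (intro exI ballI)
      fix \<phi> :: "'x \<Rightarrow> complex" assume \<phi>: "\<phi> \<in> dual_space"
      have bl: "bounded_linear \<phi>" using \<phi> by (rule dual_space_bounded_linear)
      have "(\<lambda>n. (1/2) ^ n * \<phi> (\<nu> (A n))) sums \<phi> (\<Sum>n. (1/2) ^ n *\<^sub>R \<nu> (A n))"
        using bounded_linear.sums[OF bl y]
        by (simp add: linear_scale[OF bounded_linear.linear[OF bl]] scaleR_conv_of_real)
      with complex_integral_dyadic[OF \<phi>\<nu>[OF \<phi>] dyadic]
      show "\<phi> (\<Sum>n. (1/2) ^ n *\<^sub>R \<nu> (A n)) = complex_integral T (\<lambda>A. \<phi> (\<nu> A)) (dyadic A)"
        by (rule sums_unique2[symmetric])
    qed
  qed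
  then obtain y where y: "\<And>\<phi>. \<phi> \<in> dual_space \<Longrightarrow> \<phi> y = complex_integral T (\<lambda>A. \<phi> (\<nu> A)) f"
    by blast
  then show ?thesis using vector_integral_unique[of y T \<nu> f, OF y] \<phi> by simp
qed

section \<open>Translates of a Radon measure\<close>

lemma continuous_map_measurable:
  assumes "continuous_map X Y f"
  shows "f \<in> measurable (borel_algebra X) (borel_algebra Y)"
  unfolding borel_algebra_def[of Y]
proof (rule measurable_measure_of)
  show "{U. openin Y U} \<subseteq> Pow (topspace Y)" by (auto dest: openin_subset)
  show "f \<in> space (borel_algebra X) \<rightarrow> topspace Y"
    using continuous_map_image_subset_topspace[OF assms] by (auto simp: space_borel_algebra)
  fix U assume "U \<in> {U. openin Y U}"
  then have "openin X {x \<in> topspace X. f x \<in> U}"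
    using openin_continuous_map_preimage[OF assms] by auto
  moreover have "f -` U \<inter> space (borel_algebra X) = {x \<in> topspace X. f x \<in> U}"
    by (auto simp: space_borel_algebra)
  ultimately show "f -` U \<inter> space (borel_algebra X) \<in> sets (borel_algebra X)"
    by (simp add: openin_sets_borel_algebra)
qed

lemma bounded_borel_continuous:
  assumes "compact_space T" "continuous_map T euclidean f"
  shows "bounded_borel T f"
proof -
  have "f \<in> borel_measurable (borel_algebra T)"
    using continuous_map_measurable[OF assms(2)] by (simp add: borel_algebra_def borel_def)
  moreover have "bounded (f ` topspace T)"
    using image_compactin[of T "topspace T" euclidean f] assms
    by (simp add: compact_space_def compact_imp_bounded)
  ultimately show ?thesis by (auto simp: bounded_borel_def bounded_iff)
qed

context compact_hausdorff_group
begin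

lemma r_coset_inv_eq:
  assumes "A \<subseteq> carrier G" "t \<in> carrier G"
  shows "A #> inv t = {s \<in> carrier G. s \<otimes> t \<in> A}"
proof (intro equalityI subsetI)
  fix s assume "s \<in> A #> inv t"
  then obtain h where "h \<in> A" "s = h \<otimes> inv t" by (auto simp: r_coset_def)
  then show "s \<in> {s \<in> carrier G. s \<otimes> t \<in> A}"
    using assms by (auto simp: m_assoc subset_iff)
next
  fix s assume "s \<in> {s \<in> carrier G. s \<otimes> t \<in> A}"
  then show "s \<in> A #> inv t"
    using assms unfolding r_coset_def by (auto simp: m_assoc intro!: bexI[of _ "s \<otimes> t"])
qed

lemma continuous_map_right_translation:
  assumes "t \<in> carrier G"
  shows "continuous_map T T (\<lambda>s. s \<otimes> t)"
proof -
  have "continuous_map T (prod_topology T T) (\<lambda>s. (s, t))"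
    using assms by (intro continuous_map_pairedI) (auto simp: topspace_eq)
  from continuous_map_compose[OF this continuous_mult] show ?thesis by (simp add: o_def)
qed

lemma r_coset_inv_sets:
  assumes "A \<in> sets (borel_algebra T)" "t \<in> carrier G"
  shows "A #> inv t \<in> sets (borel_algebra T)"
proof -
  have "A \<subseteq> carrier G" using sets_borel_algebra_subset[OF assms(1)] by (simp add: topspace_eq)
  then have "A #> inv t = (\<lambda>s. s \<otimes> t) -` A \<inter> space (borel_algebra T)"
    using assms(2) by (auto simp: r_coset_inv_eq space_borel_algebra topspace_eq)
  then show ?thesis
    using measurable_sets[OF continuous_map_measurable[OF continuous_map_right_translation[OF assms(2)]] assms(1)]
    by simp
qed

lemma bounded_borel_right_translation:
  assumes f: "bounded_borel T f" and t: "t \<in> carrier G"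
  shows "bounded_borel T (\<lambda>s. f (s \<otimes> t))"
proof -
  obtain B where "\<And>s. s \<in> topspace T \<Longrightarrow> norm (f s) \<le> B" using bounded_borelE[OF f] by blast
  then show ?thesis
    using measurable_compose[OF continuous_map_measurable[OF continuous_map_right_translation[OF t]]
        bounded_borel_measurable[OF f]] t
    by (intro bounded_borelI[of _ _ B]) (auto simp: topspace_eq)
qed

text \<open>Lower semicontinuity of \<open>t \<mapsto> P (U t\<^sup>-\<^sup>1)\<close> for open \<open>U\<close>. If \<open>P (U t\<^sup>-\<^sup>1) > a\<close>, a compact \<open>K \<subseteq> U t\<^sup>-\<^sup>1\<close>
  still has measure greater than \<open>a\<close>. By compactness \<open>K t' \<subseteq> U\<close> for all \<open>t'\<close> near \<open>t\<close>, that is,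
  \<open>K \<subseteq> U t'\<^sup>-\<^sup>1\<close>.\<close>

lemma openin_translate_measure_greater:
  assumes "finite_measure P" and sets_P: "sets P = sets (borel_algebra T)"
    and regular: "\<And>V \<epsilon>. openin T V \<Longrightarrow> 0 < \<epsilon> \<Longrightarrow> \<exists>K. compactin T K \<and> K \<subseteq> V \<and> measure P (V - K) < \<epsilon>"
    and U: "openin T U"
  shows "openin T {t \<in> carrier G. a < measure P (U #> inv t)}"
proof (subst openin_subopen, intro ballI)
  interpret P: finite_measure P by fact
  have UG: "U \<subseteq> carrier G" using openin_subset[OF U] by (simp add: topspace_eq)
  fix t assume "t \<in> {t \<in> carrier G. a < measure P (U #> inv t)}"
  then have t: "t \<in> carrier G" "a < measure P (U #> inv t)" by auto
  have "openin T {s \<in> topspace T. s \<otimes> t \<in> U}"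
    by (rule openin_continuous_map_preimage[OF continuous_map_right_translation[OF t(1)] U])
  then have V: "openin T (U #> inv t)" by (simp add: r_coset_inv_eq[OF UG t(1)] topspace_eq)
  obtain K where K: "compactin T K" "K \<subseteq> U #> inv t"
    "measure P ((U #> inv t) - K) < measure P (U #> inv t) - a"
    using regular[OF V, of "measure P (U #> inv t) - a"] t(2) by auto
  have K_sets: "K \<in> sets P"
    using closedin_sets_borel_algebra[OF compactin_imp_closedin[OF Hausdorff K(1)]] by (simp add: sets_P)
  have "a < measure P K"
    using P.finite_measure_Diff[of "U #> inv t" K] K K_sets openin_sets_borel_algebra[OF V]
    by (simp add: sets_P)
  define W where "W = {p \<in> topspace (prod_topology T T). (case p of (s, t) \<Rightarrow> s \<otimes> t) \<in> U}"
  have W: "openin (prod_topology T T) W"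
    unfolding W_def by (rule openin_continuous_map_preimage[OF continuous_mult U])
  have KW: "K \<times> {t} \<subseteq> W"
    using K(2) t(1) by (auto simp: W_def r_coset_inv_eq[OF UG] topspace_eq)
  have "compactin T {t}" using t(1) by (simp add: topspace_eq)
  then obtain V1 V2 where "openin T V1" and V12: "openin T V2" "K \<subseteq> V1" "{t} \<subseteq> V2" "V1 \<times> V2 \<subseteq> W"
    by (rule Wallace_theorem_prod_topology[OF K(1) _ W KW])
  show "\<exists>V. openin T V \<and> t \<in> V \<and> V \<subseteq> {t \<in> carrier G. a < measure P (U #> inv t)}"
  proof (intro exI conjI subsetI)
    fix t' assume t': "t' \<in> V2"
    then have "t' \<in> carrier G" using openin_subset[OF V12(1)] by (auto simp: topspace_eq)
    moreover have "K \<subseteq> U #> inv t'"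
    proof
      fix s assume "s \<in> K"
      then have "(s, t') \<in> W" using V12(2,4) t' by blast
      then show "s \<in> U #> inv t'"
        by (simp add: W_def r_coset_inv_eq[OF UG \<open>t' \<in> carrier G\<close>] topspace_eq)
    qed
    then have "measure P K \<le> measure P (U #> inv t')"
      using r_coset_inv_sets[OF openin_sets_borel_algebra[OF U] \<open>t' \<in> carrier G\<close>]
      by (intro P.finite_measure_mono) (auto simp: sets_P)
    ultimately show "t' \<in> {t \<in> carrier G. a < measure P (U #> inv t)}"
      using \<open>a < measure P K\<close> by simp
  qed (use V12 in auto)
qed

text \<open>Open sets are stable under intersection and generate the Borel sets, so by Dynkin's theorem it
  suffices to go from semicontinuity for open sets to complements and disjoint unions. Finiteness
  of \<open>P\<close> is what makes complements harmless.\<close>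

lemma translate_measure_borel_measurable:
  assumes "finite_measure P" and sets_P: "sets P = sets (borel_algebra T)"
    and regular: "\<And>V \<epsilon>. openin T V \<Longrightarrow> 0 < \<epsilon> \<Longrightarrow> \<exists>K. compactin T K \<and> K \<subseteq> V \<and> measure P (V - K) < \<epsilon>"
    and A: "A \<in> sets (borel_algebra T)"
  shows "(\<lambda>t. measure P (A #> inv t)) \<in> borel_measurable (borel_algebra T)"
proof -
  interpret P: finite_measure P by fact
  have "Int_stable {U. openin T U}" by (auto simp: Int_stable_def)
  moreover have "{U. openin T U} \<subseteq> Pow (topspace T)" by (auto dest: openin_subset)
  moreover have "A \<in> sigma_sets (topspace T) {U. openin T U}" using A by (simp add: sets_borel_algebra)
  ultimately show ?thesis
  proof (induction rule: sigma_sets_induct_disjoint)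
    case (basic U)
    then have "openin T {t \<in> carrier G. a < measure P (U #> inv t)}" for a
      by (intro openin_translate_measure_greater[OF assms(1-3)]) auto
    then show ?case
      by (auto simp: borel_measurable_iff_greater space_borel_algebra topspace_eq
          intro: openin_sets_borel_algebra)
  next
    case empty
    then show ?case by (simp add: r_coset_def)
  next
    case (compl A)
    then have A: "A \<in> sets (borel_algebra T)" by (simp add: sets_borel_algebra)
    have AG: "A \<subseteq> carrier G" using sets_borel_algebra_subset[OF A] by (simp add: topspace_eq)
    have "measure P ((topspace T - A) #> inv t) = measure P (topspace T) - measure P (A #> inv t)"
      if t: "t \<in> carrier G" for t
    proof -
      have "(topspace T - A) #> inv t = topspace T - (A #> inv t)"
        using t AG by (auto simp: r_coset_inv_eq topspace_eq)
      moreover have "A #> inv t \<subseteq> topspace T"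
        using t AG by (auto simp: r_coset_inv_eq topspace_eq)
      ultimately show ?thesis
        using r_coset_inv_sets[OF A t] by (simp add: P.finite_measure_Diff sets_P)
    qed
    then show ?case
      using compl.IH
      by (subst measurable_cong[where g = "\<lambda>t. measure P (topspace T) - measure P (A #> inv t)"])
         (auto simp: space_borel_algebra topspace_eq)
  next
    case (union A)
    then have A: "A n \<in> sets (borel_algebra T)" for n by (auto simp: sets_borel_algebra)
    have AG: "A n \<subseteq> carrier G" for n using sets_borel_algebra_subset[OF A] by (simp add: topspace_eq)
    have "measure P ((\<Union>n. A n) #> inv t) = (\<Sum>n. measure P (A n #> inv t))"
      if t: "t \<in> carrier G" for t
    proof -
      have "(\<Union>n. A n) #> inv t = (\<Union>n. A n #> inv t)" by (auto simp: r_coset_def)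
      moreover have "disjoint_family (\<lambda>n. A n #> inv t)"
        using union(1) by (auto simp: disjoint_family_on_def r_coset_inv_eq[OF AG t])
      then have "(\<lambda>n. measure P (A n #> inv t)) sums measure P (\<Union>n. A n #> inv t)"
        using r_coset_inv_sets[OF A t] by (intro P.finite_measure_UNION) (auto simp: sets_P)
      ultimately show ?thesis by (simp add: sums_iff)
    qed
    then show ?case
      using union
      by (subst measurable_cong[where g = "\<lambda>t. \<Sum>n. measure P (A n #> inv t)"])
         (auto simp: space_borel_algebra topspace_eq)
  qed
qed

lemma bounded_borel_translate:
  assumes \<mu>: "\<mu> \<in> radon_measures T" and A: "A \<in> sets (borel_algebra T)"
  shows "bounded_borel T (\<lambda>t. \<mu> (A #> inv t))"
proof -
  have vm: "vector_measure T \<mu>" and reg: "regular_wrt T (compactin T) (total_variation T \<mu>)"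
    using \<mu> by (auto simp: radon_measures_def)
  have regular: "\<exists>K. compactin T K \<and> K \<subseteq> V \<and> measure (jordan_part T \<mu> k) (V - K) < \<epsilon>"
    if V: "openin T V" and "0 < \<epsilon>" for V \<epsilon> k
  proof -
    interpret P: finite_measure "jordan_part T \<mu> k" by (rule finite_measure_jordan_part[OF vm])
    obtain U K where UK: "openin T U" "compactin T K" "K \<subseteq> V" "V \<subseteq> U" "total_variation T \<mu> (U - K) < ennreal \<epsilon>"
      using reg[unfolded regular_wrt_def, rule_format, OF \<open>0 < \<epsilon>\<close> openin_sets_borel_algebra[OF V]]
      by (elim exE conjE)
    have sets: "U - K \<in> sets (borel_algebra T)"
      using closedin_sets_borel_algebra[OF compactin_imp_closedin[OF Hausdorff UK(2)]]
        openin_sets_borel_algebra[OF UK(1)] by auto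
    have "measure (jordan_part T \<mu> k) (V - K) \<le> measure (jordan_part T \<mu> k) (U - K)"
      using UK(4) sets by (intro P.finite_measure_mono) auto
    moreover have "ennreal (measure (jordan_part T \<mu> k) (U - K)) < ennreal \<epsilon>"
      using emeasure_jordan_part_le_total_variation[OF vm sets, of k] UK(5) by (simp add: P.emeasure_eq_measure)
    ultimately show ?thesis using UK(2,3) by (auto simp: ennreal_less_iff)
  qed
  obtain M where M: "\<And>A. A \<in> sets (borel_algebra T) \<Longrightarrow> norm (\<mu> A) \<le> M"
    using vector_measure_bounded[OF vm] by blast
  show ?thesis
  proof (rule bounded_borelI)
    have [measurable]: "(\<lambda>t. measure (jordan_part T \<mu> k) (A #> inv t)) \<in> borel_measurable (borel_algebra T)" for k
      by (rule translate_measure_borel_measurable[OF finite_measure_jordan_part[OF vm] sets_jordan_part regular A])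
    have "(\<lambda>t. \<Sum>k<4. \<i> ^ k * complex_of_real (measure (jordan_part T \<mu> k) (A #> inv t))) \<in> borel_measurable (borel_algebra T)"
      by measurable
    then show "(\<lambda>t. \<mu> (A #> inv t)) \<in> borel_measurable (borel_algebra T)"
      using r_coset_inv_sets[OF A] measure_jordan_part[OF vm]
      by (subst measurable_cong[where g = "\<lambda>t. \<Sum>k<4. \<i> ^ k * complex_of_real (measure (jordan_part T \<mu> k) (A #> inv t))"])
         (auto simp: space_borel_algebra topspace_eq)
    show "norm (\<mu> (A #> inv t)) \<le> M" if "t \<in> topspace T" for t
      using that by (intro M r_coset_inv_sets[OF A]) (simp add: topspace_eq)
  qed
qed

section \<open>Integration against a convolution\<close>

text \<open>Pointwise in \<open>t\<close> the partial sums of \<open>\<mu> (A n t\<^sup>-\<^sup>1)\<close> are values of \<open>\<mu>\<close> on finite unions, hence bounded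
  uniformly in \<open>t\<close> and in the number of terms, and dominated convergence applies.\<close>

lemma vector_measure_convolution:
  fixes \<kappa> :: "'g set \<Rightarrow> complex"
  assumes \<mu>: "\<mu> \<in> radon_measures T" and \<kappa>: "vector_measure T \<kappa>"
  shows "vector_measure T (\<lambda>A. complex_integral T \<kappa> (\<lambda>t. \<mu> (A #> inv t)))"
  unfolding vector_measure_def
proof (intro allI impI)
  fix A :: "nat \<Rightarrow> 'g set"
  assume "range A \<subseteq> sets (borel_algebra T)" and disj: "disjoint_family A"
  then have A: "A n \<in> sets (borel_algebra T)" for n by auto
  have vm: "vector_measure T \<mu>" using \<mu> by (auto simp: radon_measures_def)
  obtain M where M: "\<And>A. A \<in> sets (borel_algebra T) \<Longrightarrow> norm (\<mu> A) \<le> M"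
    using vector_measure_bounded[OF vm] by blast
  have bb: "bounded_borel T (\<lambda>t. \<mu> (A n #> inv t))" for n by (rule bounded_borel_translate[OF \<mu> A])
  have AG: "A n \<subseteq> carrier G" for n using sets_borel_algebra_subset[OF A] by (simp add: topspace_eq)
  have t_sets: "A n #> inv t \<in> sets (borel_algebra T)" and t_disj: "disjoint_family (\<lambda>n. A n #> inv t)"
    if t: "t \<in> topspace T" for t n
  proof -
    have t: "t \<in> carrier G" using t by (simp add: topspace_eq)
    show "A n #> inv t \<in> sets (borel_algebra T)" by (rule r_coset_inv_sets[OF A t])
    show "disjoint_family (\<lambda>n. A n #> inv t)"
      using disj by (auto simp: disjoint_family_on_def r_coset_inv_eq[OF AG t])
  qed
  have "(\<lambda>N. complex_integral T \<kappa> (\<lambda>t. \<Sum>n<N. \<mu> (A n #> inv t))) \<longlonglongrightarrow>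
      complex_integral T \<kappa> (\<lambda>t. \<mu> ((\<Union>n. A n) #> inv t))"
  proof (rule complex_integral_bounded_convergence(2)[OF \<kappa>, where B = M])
    show "(\<lambda>t. \<Sum>n<N. \<mu> (A n #> inv t)) \<in> borel_measurable (borel_algebra T)" for N
      by (intro bounded_borel_measurable bounded_borel_sum bb)
    fix t assume t: "t \<in> topspace T"
    show "norm (\<Sum>n<N. \<mu> (A n #> inv t)) \<le> M" for N
      unfolding vector_measure_UN_lessThan[OF vm t_sets[OF t] t_disj[OF t], symmetric]
      by (intro M sets.finite_UN) (auto intro: t_sets[OF t])
    have "(\<Union>n. A n) #> inv t = (\<Union>n. A n #> inv t)" by (auto simp: r_coset_def)
    then show "(\<lambda>N. \<Sum>n<N. \<mu> (A n #> inv t)) \<longlonglongrightarrow> \<mu> ((\<Union>n. A n) #> inv t)"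
      using vector_measure_sums[OF vm t_sets[OF t] t_disj[OF t]] by (simp add: sums_def)
  qed
  then show "(\<lambda>n. complex_integral T \<kappa> (\<lambda>t. \<mu> (A n #> inv t))) sums
      complex_integral T \<kappa> (\<lambda>t. \<mu> ((\<Union>n. A n) #> inv t))"
    by (simp add: sums_def complex_integral_sum[OF \<kappa> bb])
qed

text \<open>The substitute for Fubini's theorem. For a dyadic function the translate \<open>s \<mapsto> f (s t)\<close> is dyadic
  with digit sets \<open>A n t\<^sup>-\<^sup>1\<close>, so both sides are the same series of values of the convolution.
  Measurability of the inner integral is proved in the same induction, since it is needed for the
  outer integral to be linear.\<close>

lemma complex_integral_convolution:
  fixes \<kappa> :: "'g set \<Rightarrow> complex"
  assumes \<mu>: "\<mu> \<in> radon_measures T" and \<kappa>: "vector_measure T \<kappa>" and f: "bounded_borel T f"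
  shows "bounded_borel T (\<lambda>t. complex_integral T \<mu> (\<lambda>s. f (s \<otimes> t)))" (is "?bb f")
    and "complex_integral T (\<lambda>A. complex_integral T \<kappa> (\<lambda>t. \<mu> (A #> inv t))) f =
      complex_integral T \<kappa> (\<lambda>t. complex_integral T \<mu> (\<lambda>s. f (s \<otimes> t)))" (is "?eq f")
proof -
  have vm: "vector_measure T \<mu>" using \<mu> by (auto simp: radon_measures_def)
  let ?c = "\<lambda>A. complex_integral T \<kappa> (\<lambda>t. \<mu> (A #> inv t))"
  let ?F = "\<lambda>f t. complex_integral T \<mu> (\<lambda>s. f (s \<otimes> t))"
  have c: "vector_measure T ?c" by (rule vector_measure_convolution[OF \<mu> \<kappa>])
  have transl: "bounded_borel T (\<lambda>s. f (s \<otimes> t))" if "bounded_borel T f" "t \<in> topspace T" for f t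
    using that by (intro bounded_borel_right_translation) (auto simp: topspace_eq)
  from f have "?bb f \<and> ?eq f"
  proof (induction rule: bounded_borel_induct)
    case (cong f g)
    have F: "?F f t = ?F g t" if "t \<in> topspace T" for t
      using that cong(1) by (intro complex_integral_cong) (auto simp: topspace_eq)
    show ?case
      using cong(2) bounded_borel_cong[of T "?F f" "?F g", OF F] complex_integral_cong[of T f g, OF cong(1)]
        complex_integral_cong[of T "?F f" "?F g", OF F] by simp
  next
    case (add f g)
    have F: "?F f t + ?F g t = ?F (\<lambda>s. f s + g s) t" if "t \<in> topspace T" for t
      using that add by (simp add: complex_integral_add[OF vm] transl)
    have "bounded_borel T (\<lambda>t. ?F f t + ?F g t)" using add by (auto intro: bounded_borel_add)
    then have "?bb (\<lambda>s. f s + g s)"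
      by (rule bounded_borel_cong[rotated]) (simp add: F)
    moreover have "complex_integral T \<kappa> (?F (\<lambda>s. f s + g s)) = complex_integral T \<kappa> (\<lambda>t. ?F f t + ?F g t)"
      by (rule complex_integral_cong) (simp add: F)
    ultimately show ?case
      using add by (simp add: complex_integral_add[OF c] complex_integral_add[OF \<kappa>])
  next
    case (cmult a f)
    have F: "a * ?F f t = ?F (\<lambda>s. a * f s) t" if "t \<in> topspace T" for t
      using that cmult by (simp add: complex_integral_cmult transl)
    have "bounded_borel T (\<lambda>t. a * ?F f t)" using cmult by (auto intro: bounded_borel_cmult)
    then have "?bb (\<lambda>s. a * f s)"
      by (rule bounded_borel_cong[rotated]) (simp add: F)
    moreover have "complex_integral T \<kappa> (?F (\<lambda>s. a * f s)) = complex_integral T \<kappa> (\<lambda>t. a * ?F f t)"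
      by (rule complex_integral_cong) (simp add: F)
    ultimately show ?case
      using cmult by (simp add: complex_integral_cmult)
  next
    case (dyadic A)
    obtain M where M: "\<And>A. A \<in> sets (borel_algebra T) \<Longrightarrow> norm (\<mu> A) \<le> M"
      using vector_measure_bounded[OF vm] by blast
    have AG: "A n \<subseteq> carrier G" for n using sets_borel_algebra_subset[OF dyadic] by (simp add: topspace_eq)
    have bb: "bounded_borel T (\<lambda>t. (1/2) ^ n * \<mu> (A n #> inv t))" for n
      by (intro bounded_borel_cmult bounded_borel_translate[OF \<mu>] dyadic)
    have t_sets: "A n #> inv t \<in> sets (borel_algebra T)" if "t \<in> topspace T" for n t
      using that by (intro r_coset_inv_sets dyadic) (simp add: topspace_eq)
    have lim: "(\<lambda>N. \<Sum>n<N. (1/2) ^ n * \<mu> (A n #> inv t)) \<longlonglongrightarrow> ?F (dyadic A) t"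
      if t: "t \<in> topspace T" for t
    proof -
      have "?F (dyadic A) t = complex_integral T \<mu> (dyadic (\<lambda>n. A n #> inv t))"
        using t by (intro complex_integral_cong)
          (simp add: dyadic_def topspace_eq r_coset_inv_eq[OF AG] indicator_def)
      then show ?thesis
        using complex_integral_dyadic[OF vm t_sets[OF t]] by (simp add: sums_def)
    qed
    have bound: "norm (\<Sum>n<N. (1/2) ^ n * \<mu> (A n #> inv t)) \<le> 2 * M" if t: "t \<in> topspace T" for N t
    proof -
      have "norm (\<Sum>n<N. (1/2) ^ n * \<mu> (A n #> inv t)) \<le> (\<Sum>n<N. (1/2) ^ n * M)"
        by (intro sum_norm_le) (simp add: norm_mult norm_power norm_divide M t_sets[OF t])
      also have "\<dots> \<le> (\<Sum>n. (1/2) ^ n) * M"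
        unfolding sum_distrib_right[symmetric]
        using order_trans[OF norm_ge_zero M[OF topspace_sets_borel_algebra]]
        by (intro mult_right_mono sum_le_suminf) auto
      finally show ?thesis by (simp add: suminf_geometric)
    qed
    have meas: "(\<lambda>t. \<Sum>n<N. (1/2) ^ n * \<mu> (A n #> inv t)) \<in> borel_measurable (borel_algebra T)" for N
      by (intro bounded_borel_measurable bounded_borel_sum bb)
    note conv = complex_integral_bounded_convergence[OF \<kappa> meas bound lim]
    have "complex_integral T \<kappa> (\<lambda>t. \<Sum>n<N. (1/2) ^ n * \<mu> (A n #> inv t)) = (\<Sum>n<N. (1/2) ^ n * ?c (A n))" for N
      by (simp add: complex_integral_sum[OF \<kappa> bb] complex_integral_cmult)
    then have "(\<lambda>n. (1/2) ^ n * ?c (A n)) sums complex_integral T \<kappa> (?F (dyadic A))"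
      using conv(2) by (simp add: sums_def)
    with complex_integral_dyadic[of T ?c A, OF c dyadic] have "?eq (dyadic A)" by (rule sums_unique2)
    with conv(1) show ?case ..
  qed
  then show "?bb f" "?eq f" by auto
qed

end

section \<open>Matrix coefficients\<close>

text \<open>By polarization the inner product is a polynomial in norms, so continuity follows without the
  Cauchy-Schwarz inequality.\<close>

lemma continuous_on_cinner: "continuous_on S (\<lambda>x::'h::complex_inner. cinner x y)"
proof -
  have Re: "Re (cinner x y) = ((norm (x + y))\<^sup>2 - (norm x)\<^sup>2 - (norm y)\<^sup>2) / 2" for x y :: 'h
  proof -
    have "cinner (x + y) (x + y) = cinner x x + cinner y y + (cinner x y + cnj (cinner x y))"
      using cinner_add_left[of x y "x + y"] cinner_commute[of x "x + y"] cinner_commute[of y "x + y"]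
      by (simp add: cinner_add_left cinner_commute[of y x])
         (metis add.commute cinner_commute)
    then show ?thesis
      unfolding cinner_self complex_eq_iff by simp
  qed
  have "cinner x y = complex_of_real (Re (cinner x y)) + \<i> * complex_of_real (Re (cinner ((- \<i>) *\<^sub>C x) y))" for x
    by (simp add: cinner_scaleC_left complex_eq_iff)
  then have "(\<lambda>x. cinner x y) = (\<lambda>x. complex_of_real (((norm (x + y))\<^sup>2 - (norm x)\<^sup>2 - (norm y)\<^sup>2) / 2) +
      \<i> * complex_of_real (((norm ((- \<i>) *\<^sub>C x + y))\<^sup>2 - (norm ((- \<i>) *\<^sub>C x))\<^sup>2 - (norm y)\<^sup>2) / 2))"
    unfolding Re by (rule ext)
  then show ?thesis
    by (simp only:) (intro continuous_intros bounded_linear.continuous_on[OF scaleC_bounded_linear]; simp)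
qed

lemma cinner_sum_left: "cinner (\<Sum>i\<in>I. f i) y = (\<Sum>i\<in>I. cinner (f i) y)"
proof -
  have "cinner 0 y = 0" using cinner_add_left[of 0 0 y] by simp
  then show ?thesis by (induction I rule: infinite_finite_induct) (auto simp: cinner_add_left)
qed

lemma module_scaleC: "Modules.module (scaleC :: complex \<Rightarrow> 'h::complex_normed_vector \<Rightarrow> 'h)"
proof
  show "1 *\<^sub>C x = x" for x :: 'h using scaleC_of_real[of 1 x] by simp
qed (auto simp: scaleC_add_right scaleC_add_left scaleC_scaleC)

lemma orthonormal_basis_expansion:
  fixes e :: "nat \<Rightarrow> 'h::complex_inner"
  assumes e: "orthonormal_basis e"
  shows "x = (\<Sum>k<cdim TYPE('h). cinner x (e k) *\<^sub>C e k)"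
proof -
  interpret Modules.module "scaleC :: complex \<Rightarrow> 'h \<Rightarrow> 'h" by (rule module_scaleC)
  let ?d = "cdim TYPE('h)"
  define L where "L x = (\<Sum>k<?d. cinner x (e k) *\<^sub>C e k)" for x
  have cinner_0: "cinner 0 y = 0" for y :: 'h using cinner_add_left[of 0 0 y] by simp
  have x: "x \<in> span (e ` {..<?d})" using e by (simp add: orthonormal_basis_def)
  have subspace_L: "subspace {x. L x = x}"
  proof (rule subspaceI)
    show "0 \<in> {x. L x = x}" by (simp add: L_def cinner_0)
    have "L (x + y) = L x + L y" for x y
      by (simp add: L_def cinner_add_left scaleC_add_left sum.distrib)
    then show "x + y \<in> {x. L x = x}" if "x \<in> {x. L x = x}" "y \<in> {x. L x = x}" for x y
      using that by simp
    have "L (c *\<^sub>C x) = c *\<^sub>C L x" for c x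
      by (simp add: L_def cinner_scaleC_left scaleC_scaleC scale_sum_right)
    then show "c *\<^sub>C x \<in> {x. L x = x}" if "x \<in> {x. L x = x}" for c x
      using that by simp
  qed
  have L_e: "L (e i) = e i" if i: "i < ?d" for i
  proof -
    have "L (e i) = (\<Sum>k<?d. if k = i then e i else 0)"
      unfolding L_def using e i by (intro sum.cong) (auto simp: orthonormal_basis_def)
    then show ?thesis using i by simp
  qed
  have "L x = x" using x subspace_L by (rule span_induct) (use L_e in auto)
  then show ?thesis by (simp add: L_def)
qed

lemma matrix_coeff_mult:
  fixes G (structure) and \<pi> :: "'g \<Rightarrow> 'h::{complex_inner, banach} \<Rightarrow> 'h"
  assumes \<pi>: "irreducible_unitary_rep G T \<pi>" and e: "orthonormal_basis e" and st: "s \<in> carrier G" "t \<in> carrier G"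
  shows "matrix_coeff \<pi> e j i (s \<otimes> t) =
    (\<Sum>k<cdim TYPE('h). matrix_coeff \<pi> e j k s * matrix_coeff \<pi> e k i t)"
proof -
  interpret irreducible_unitary_rep G T \<pi> by fact
  let ?d = "cdim TYPE('h)"
  have add: "\<pi> s (x + y) = \<pi> s x + \<pi> s y" and scale: "\<pi> s (c *\<^sub>C x) = c *\<^sub>C \<pi> s x" for x y c
    using unitary[OF st(1)] by (auto simp: unitary_operator_def)
  have "\<pi> s 0 = 0" using add[of 0 0] by simp
  then have sum: "\<pi> s (\<Sum>k\<in>I. f k) = (\<Sum>k\<in>I. \<pi> s (f k))" for f and I :: "nat set"
    by (induction I rule: infinite_finite_induct) (auto simp: add)
  have "matrix_coeff \<pi> e j i (s \<otimes> t) = cinner (\<pi> s (\<pi> t (e i))) (e j)"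
    by (simp add: matrix_coeff_def mult[OF st])
  also have "\<pi> t (e i) = (\<Sum>k<?d. cinner (\<pi> t (e i)) (e k) *\<^sub>C e k)"
    by (rule orthonormal_basis_expansion[OF e])
  finally show ?thesis
    by (simp add: sum scale cinner_sum_left cinner_scaleC_left matrix_coeff_def mult.commute)
qed

lemma (in irreducible_unitary_rep) bounded_borel_cnj_matrix_coeff:
  assumes "compact_space T"
  shows "bounded_borel T (\<lambda>t. cnj (matrix_coeff \<pi> e i j t))"
proof (rule bounded_borel_continuous[OF assms])
  have "continuous_on UNIV (\<lambda>x. cnj (cinner x (e i)))"
    by (intro continuous_intros continuous_on_cinner)
  then have "continuous_map euclidean euclidean (\<lambda>x. cnj (cinner x (e i)))" by simp
  from continuous_map_compose[OF strongly_continuous this]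
  show "continuous_map T euclidean (\<lambda>t. cnj (matrix_coeff \<pi> e i j t))"
    by (simp add: matrix_coeff_def o_def)
qed

section \<open>The convolution theorem\<close>

text \<open>The theorem without normalization, entry by entry. Applying a functional turns the integral
  against the convolution into a double integral, whose integrand separates by
  \<open>matrix_coeff_mult\<close>.\<close>

lemma vector_integral_conv_matrix_coeff:
  fixes G :: "('g, 'm) monoid_scheme" and T :: "'g topology"
    and \<mu> :: "'g set \<Rightarrow> complex" and \<nu> :: "'g set \<Rightarrow> 'x::{complex_normed_vector, banach}"
    and \<pi> :: "'g \<Rightarrow> 'h::{complex_inner, banach} \<Rightarrow> 'h" and e :: "nat \<Rightarrow> 'h"
  assumes G: "compact_hausdorff_group G T" and \<mu>: "\<mu> \<in> radon_measures T" and \<nu>: "vector_measure T \<nu>"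
    and \<pi>: "irreducible_unitary_rep G T \<pi>" and e: "orthonormal_basis e"
  shows "vector_integral T (conv G T \<mu> \<nu>) (\<lambda>t. cnj (matrix_coeff \<pi> e j i t)) =
    (\<Sum>k<cdim TYPE('h). complex_integral T \<mu> (\<lambda>t. cnj (matrix_coeff \<pi> e j k t)) *\<^sub>C
       vector_integral T \<nu> (\<lambda>t. cnj (matrix_coeff \<pi> e k i t)))"
proof (rule vector_integral_unique)
  interpret G: compact_hausdorff_group G T by fact
  interpret \<pi>: irreducible_unitary_rep G T \<pi> by fact
  let ?d = "cdim TYPE('h)"
  let ?f = "\<lambda>i j t. cnj (matrix_coeff \<pi> e i j t)"
  have bb: "bounded_borel T (?f i j)" for i j
    by (rule \<pi>.bounded_borel_cnj_matrix_coeff[OF G.compact])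
  have vm: "vector_measure T \<mu>" using \<mu> by (auto simp: radon_measures_def)
  fix \<phi> :: "'x \<Rightarrow> complex" assume \<phi>: "\<phi> \<in> dual_space"
  have \<phi>\<nu>: "vector_measure T (\<lambda>A. \<phi> (\<nu> A))" by (rule vector_measure_dual[OF \<nu> \<phi>])
  have "complex_integral T (\<lambda>A. \<phi> (conv G T \<mu> \<nu> A)) (?f j i) =
      complex_integral T (\<lambda>A. complex_integral T (\<lambda>A. \<phi> (\<nu> A)) (\<lambda>t. \<mu> (A #>\<^bsub>G\<^esub> inv\<^bsub>G\<^esub> t))) (?f j i)"
    unfolding conv_def
    by (intro complex_integral_cong_measure dual_vector_integral \<nu> \<phi> G.bounded_borel_translate \<mu>)
  also have "\<dots> = complex_integral T (\<lambda>A. \<phi> (\<nu> A)) (\<lambda>t. complex_integral T \<mu> (\<lambda>s. ?f j i (s \<otimes>\<^bsub>G\<^esub> t)))"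
    by (rule G.complex_integral_convolution(2)[OF \<mu> \<phi>\<nu> bb])
  also have "\<dots> = complex_integral T (\<lambda>A. \<phi> (\<nu> A)) (\<lambda>t. \<Sum>k<?d. complex_integral T \<mu> (?f j k) * ?f k i t)"
  proof (rule complex_integral_cong)
    fix t assume t: "t \<in> topspace T"
    have "complex_integral T \<mu> (\<lambda>s. ?f j i (s \<otimes>\<^bsub>G\<^esub> t)) =
        complex_integral T \<mu> (\<lambda>s. \<Sum>k<?d. ?f k i t * ?f j k s)"
      using t by (intro complex_integral_cong)
        (simp add: matrix_coeff_mult[OF \<pi> e] G.topspace_eq mult.commute)
    also have "\<dots> = (\<Sum>k<?d. complex_integral T \<mu> (?f j k) * ?f k i t)"
      by (simp add: complex_integral_sum[OF vm] complex_integral_cmult bounded_borel_cmult bb mult.commute)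
    finally show "complex_integral T \<mu> (\<lambda>s. ?f j i (s \<otimes>\<^bsub>G\<^esub> t)) = (\<Sum>k<?d. complex_integral T \<mu> (?f j k) * ?f k i t)" .
  qed
  also have "\<dots> = (\<Sum>k<?d. complex_integral T \<mu> (?f j k) * \<phi> (vector_integral T \<nu> (?f k i)))"
    by (simp add: complex_integral_sum[OF \<phi>\<nu>] complex_integral_cmult bounded_borel_cmult bb
        dual_vector_integral[OF \<nu> bb \<phi>])
  also have "\<dots> = \<phi> (\<Sum>k<?d. complex_integral T \<mu> (?f j k) *\<^sub>C vector_integral T \<nu> (?f k i))"
    by (simp add: linear_sum[OF bounded_linear.linear[OF dual_space_bounded_linear[OF \<phi>]]]
        dual_space_scaleC[OF \<phi>])
  finally show "\<phi> (\<Sum>k<?d. complex_integral T \<mu> (?f j k) *\<^sub>C vector_integral T \<nu> (?f k i)) =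
      complex_integral T (\<lambda>A. \<phi> (conv G T \<mu> \<nu> A)) (?f j i)" by simp
qed

theorem theorem8p3:
  fixes G :: "('g, 'm) monoid_scheme" and T :: "'g topology"
    and mnorm :: "'x::{complex_normed_vector, banach} mat \<Rightarrow> real"
    and \<mu> :: "'g set \<Rightarrow> complex" and \<nu> :: "'g set \<Rightarrow> 'x"
    and \<pi> :: "'g \<Rightarrow> 'h::{complex_inner, banach} \<Rightarrow> 'h" and e :: "nat \<Rightarrow> 'h"
  assumes "compact_hausdorff_group G T"
    and "operator_space mnorm"
    and "\<mu> \<in> radon_measures T"
    and "\<nu> \<in> regular_vector_measures T"
    and "irreducible_unitary_rep G T \<pi>"
    and "orthonormal_basis e"
  shows "fourier_vector_measure T \<pi> e (conv G T \<mu> \<nu>) =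
    map_mat (\<lambda>x. of_nat (cdim TYPE('h)) *\<^sub>C x)
      (mat_rmult (fourier_vector_measure T \<pi> e \<nu>) (fourier_measure T \<pi> e \<mu>))"
proof (rule eq_matI)
  let ?d = "cdim TYPE('h)"
  let ?R = "map_mat (\<lambda>x. of_nat ?d *\<^sub>C x)
      (mat_rmult (fourier_vector_measure T \<pi> e \<nu>) (fourier_measure T \<pi> e \<mu>))"
  have \<nu>: "vector_measure T \<nu>" using assms(4) by (simp add: regular_vector_measures_def)
  interpret X: Modules.module "scaleC :: complex \<Rightarrow> 'x \<Rightarrow> 'x" by (rule module_scaleC)
  show "dim_row (fourier_vector_measure T \<pi> e (conv G T \<mu> \<nu>)) = dim_row ?R"
    "dim_col (fourier_vector_measure T \<pi> e (conv G T \<mu> \<nu>)) = dim_col ?R"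
    by (simp_all add: fourier_vector_measure_def fourier_measure_def mat_rmult_def)
  fix i j assume "i < dim_row ?R" "j < dim_col ?R"
  then have ij: "i < ?d" "j < ?d"
    by (simp_all add: fourier_vector_measure_def fourier_measure_def mat_rmult_def)
  then have "of_nat ?d \<noteq> (0::complex)" by simp
  then show "fourier_vector_measure T \<pi> e (conv G T \<mu> \<nu>) $$ (i, j) = ?R $$ (i, j)"
    using ij vector_integral_conv_matrix_coeff[OF assms(1,3) \<nu> assms(5,6), of j i]
    by (simp add: fourier_vector_measure_def fourier_measure_def mat_rmult_def X.scale_sum_right
        scaleC_scaleC field_simps)
qed

end
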